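(* Let $E$ and $F$ be Banach spaces and suppose that there exist bounded nets of compact operators $\{K_\alpha\}_\alpha\subset\mathcal K(E)$ and $\{L_\beta\}_\beta\subset\mathcal K(F)$ and numbers $1<p,q<\infty$ such that: (1) $K_\alpha^*(x^* )\to x^*$ for all $x^*\in E^*$, and $L_\beta(y)\to y$ for all $y\in F$; (2) for all $\varepsilon>0$ and all $\alpha_0$ there exists $\alpha>\alpha_0$ such that for every $x\in E$, $\|K_\alpha(x)\|^p+\|x-K_\alpha(x)\|^p\le(1+\varepsilon)^p\|x\|^p$; (3) for all $\varepsilon>0$ and all $\beta_0$ there exists $\beta>\beta_0$ such that for every $y_1,y_2\in F$, $\|L_\beta(y_1)+(Id-L_\beta)(y_2)\|^q\le(1+\varepsilon)^q\big(\|y_1\|^q+\|y_2\|^q\big)$. Suppose also that $n=cd(E,F)$ satisfies $p\le nq$ and $n<cd(E)$. Then $\mathcal P_w(^nE,F)$ is an $M$-ideal in $\mathcal P(^nE,F)$.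
   Context: $\mathcal P(^nE,F)$ is the Banach space of continuous $n$-homogeneous polynomials $P:E\to F$ with norm $\|P\|=\sup_{\|x\|\le1}\|P(x)\|$. $\mathcal P_w(^nE,F)$ is the subspace of polynomials that are weakly continuous on bounded sets: $\|P(x_\alpha)-P(x)\|\to0$ for every bounded net $(x_\alpha)$ converging weakly to $x\in E$. $\mathcal K(X)$ denotes the compact linear operators on $X$. The critical degree $cd(E,F)$ is the smallest $k\ge1$ such that $\mathcal P_w(^kE,F)\ne\mathcal P(^kE,F)$ (the hypothesis $n=cd(E,F)$ includes that it exists); $cd(E)=cd(E,\mathbb K)$, with $cd(E)=\infty$ if no such $k$ exists. A closed subspace $J$ of a Banach space $X$ is an $M$-ideal if there is a linear projection $\pi$ on $X^*$ with kernel $J^\perp$ such that $\|x^*\|=\|\pi(x^* )\|+\|x^*-\pi(x^* )\|$ for all $x^*\in X^*$. *)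

theory Defs
  imports "HOL-Analysis.Analysis" "HOL-Library.Function_Algebras" "HOL-Library.Extended_Nat"
begin

text \<open>
  The scalar field is either the reals or the complex numbers: the class below
  consists, up to isometric isomorphism, of exactly these two fields.
\<close>

class rc_field = real_normed_field +
  assumes real_or_complex:
    "\<exists>\<phi> :: 'a \<Rightarrow> complex.
       (\<forall>a b. \<phi> (a + b) = \<phi> a + \<phi> b) \<and> (\<forall>a b. \<phi> (a * b) = \<phi> a * \<phi> b) \<and>
       (\<forall>r a. \<phi> (scaleR r a) = scaleR r (\<phi> a)) \<and> (\<forall>a. cmod (\<phi> a) = norm a) \<and>
       (range \<phi> = \<real> \<or> range \<phi> = UNIV)"

instance real :: rc_field
proof
  show "\<exists>\<phi> :: real \<Rightarrow> complex.
       (\<forall>a b. \<phi> (a + b) = \<phi> a + \<phi> b) \<and> (\<forall>a b. \<phi> (a * b) = \<phi> a * \<phi> b) \<and>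
       (\<forall>r a. \<phi> (scaleR r a) = scaleR r (\<phi> a)) \<and> (\<forall>a. cmod (\<phi> a) = norm a) \<and>
       (range \<phi> = \<real> \<or> range \<phi> = UNIV)"
    by (rule exI[of _ complex_of_real]) (auto simp: Reals_def scaleR_conv_of_real)
qed

instance complex :: rc_field
proof
  show "\<exists>\<phi> :: complex \<Rightarrow> complex.
       (\<forall>a b. \<phi> (a + b) = \<phi> a + \<phi> b) \<and> (\<forall>a b. \<phi> (a * b) = \<phi> a * \<phi> b) \<and>
       (\<forall>r a. \<phi> (scaleR r a) = scaleR r (\<phi> a)) \<and> (\<forall>a. cmod (\<phi> a) = norm a) \<and>
       (range \<phi> = \<real> \<or> range \<phi> = UNIV)"
    by (rule exI[of _ "\<lambda>z. z"]) auto
qed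

text \<open>
  A Banach space over the scalar field: the class \<^class>\<open>banach\<close> provides addition, the
  complete norm and the underlying real scalar multiplication; the locale adds the scalar
  multiplication \<open>s\<close> by the whole scalar field, which extends the real one.
\<close>

locale banach_over = vector_space s
  for s :: "'k::rc_field \<Rightarrow> 'e::banach \<Rightarrow> 'e" +
  assumes norm_scale: "norm (s c x) = norm c * norm x"
    and scale_of_real: "s (of_real r) x = scaleR r x"

lemma banach_over_real: "banach_over (scaleR :: real \<Rightarrow> 'e::banach \<Rightarrow> 'e)"
  by unfold_locales (auto simp: algebra_simps)

lemma banach_over_complex: "banach_over ((*) :: complex \<Rightarrow> complex \<Rightarrow> complex)"
  by unfold_locales (auto simp: algebra_simps norm_mult scaleR_conv_of_real)

text \<open>
  Normed spaces are given by a carrier \<open>X\<close>, a norm \<open>N\<close> and a scalar multiplication \<open>s\<close>; this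
  is needed because the space of \<open>n\<close>-homogeneous polynomials depends on the value of \<open>n\<close>.
  Functionals on \<open>X\<close> are extended by \<open>0\<close> outside \<open>X\<close>, so that equality of functionals on \<open>X\<close>
  is equality of functions.
\<close>

definition dual_space ::
  "('k::rc_field \<Rightarrow> 'v::ab_group_add \<Rightarrow> 'v) \<Rightarrow> ('v \<Rightarrow> real) \<Rightarrow> 'v set \<Rightarrow> ('v \<Rightarrow> 'k) set"
  where "dual_space s N X =
    {f. (\<forall>u\<in>X. \<forall>v\<in>X. f (u + v) = f u + f v) \<and>
        (\<forall>c. \<forall>v\<in>X. f (s c v) = c * f v) \<and>
        (\<exists>C. \<forall>v\<in>X. norm (f v) \<le> C * N v) \<and>
        (\<forall>v. v \<notin> X \<longrightarrow> f v = 0)}"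

definition dual_norm ::
  "('v \<Rightarrow> real) \<Rightarrow> 'v set \<Rightarrow> ('v \<Rightarrow> 'k::rc_field) \<Rightarrow> real"
  where "dual_norm N X f = (SUP v\<in>{v \<in> X. N v \<le> 1}. norm (f v))"

definition annihilator ::
  "('k::rc_field \<Rightarrow> 'v::ab_group_add \<Rightarrow> 'v) \<Rightarrow> ('v \<Rightarrow> real) \<Rightarrow> 'v set \<Rightarrow> 'v set \<Rightarrow> ('v \<Rightarrow> 'k) set"
  where "annihilator s N X J = {f \<in> dual_space s N X. \<forall>v\<in>J. f v = 0}"

definition M_ideal ::
  "('k::rc_field \<Rightarrow> 'v::ab_group_add \<Rightarrow> 'v) \<Rightarrow> ('v \<Rightarrow> real) \<Rightarrow> 'v set \<Rightarrow> 'v set \<Rightarrow> bool"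
  where "M_ideal s N X J \<longleftrightarrow>
    module.subspace s X \<and> module.subspace s J \<and> J \<subseteq> X \<and>
    (\<forall>v\<in>X. (\<forall>e>0. \<exists>u\<in>J. N (v - u) < e) \<longrightarrow> v \<in> J) \<and>
    (\<exists>\<pi>. (\<forall>f\<in>dual_space s N X. \<pi> f \<in> dual_space s N X) \<and>
         (\<forall>f\<in>dual_space s N X. \<forall>g\<in>dual_space s N X. \<pi> (f + g) = \<pi> f + \<pi> g) \<and>
         (\<forall>c. \<forall>f\<in>dual_space s N X. \<pi> (\<lambda>v. c * f v) = (\<lambda>v. c * \<pi> f v)) \<and>
         (\<forall>f\<in>dual_space s N X. \<pi> (\<pi> f) = \<pi> f) \<and>
         {f \<in> dual_space s N X. \<pi> f = 0} = annihilator s N X J \<and>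
         (\<forall>f\<in>dual_space s N X.
            dual_norm N X f = dual_norm N X (\<pi> f) + dual_norm N X (f - \<pi> f)))"

text \<open>
  An \<open>n\<close>-linear map takes a sequence of arguments and depends only on the first \<open>n\<close> of them.
\<close>

definition multilinear ::
  "nat \<Rightarrow> ('k::rc_field \<Rightarrow> 'e::real_normed_vector \<Rightarrow> 'e) \<Rightarrow> ('k \<Rightarrow> 'f::real_normed_vector \<Rightarrow> 'f) \<Rightarrow>
   ((nat \<Rightarrow> 'e) \<Rightarrow> 'f) \<Rightarrow> bool"
  where "multilinear n sE sF A \<longleftrightarrow>
    (\<forall>v w. (\<forall>i<n. v i = w i) \<longrightarrow> A v = A w) \<and>
    (\<forall>i<n. \<forall>v. Vector_Spaces.linear sE sF (\<lambda>x. A (v(i := x))))"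

definition poly_space ::
  "nat \<Rightarrow> ('k::rc_field \<Rightarrow> 'e::real_normed_vector \<Rightarrow> 'e) \<Rightarrow> ('k \<Rightarrow> 'f::real_normed_vector \<Rightarrow> 'f) \<Rightarrow>
   ('e \<Rightarrow> 'f) set"
  where "poly_space n sE sF =
    {P. (\<exists>A. multilinear n sE sF A \<and> (\<forall>x. P x = A (\<lambda>_. x))) \<and> continuous_on UNIV P}"

definition poly_norm :: "('e::real_normed_vector \<Rightarrow> 'f::real_normed_vector) \<Rightarrow> real"
  where "poly_norm P = (SUP x\<in>cball 0 1. norm (P x))"

definition poly_scale ::
  "('k::rc_field \<Rightarrow> 'f::real_normed_vector \<Rightarrow> 'f) \<Rightarrow> 'k \<Rightarrow> ('e \<Rightarrow> 'f) \<Rightarrow> 'e \<Rightarrow> 'f"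
  where "poly_scale sF c P = (\<lambda>x. sF c (P x))"

text \<open>
  Bounded nets in \<open>'e\<close>, over arbitrary directed index sets, are represented by the filters they
  generate: the filter of a bounded net contains a bounded set, and every proper filter containing a
  bounded set is generated by a bounded net.
\<close>

definition weakly_continuous_on_bounded_sets ::
  "('k::rc_field \<Rightarrow> 'e::real_normed_vector \<Rightarrow> 'e) \<Rightarrow> ('e \<Rightarrow> 'f::real_normed_vector) \<Rightarrow> bool"
  where "weakly_continuous_on_bounded_sets sE P \<longleftrightarrow>
    (\<forall>G x. (\<exists>r. \<forall>\<^sub>F y in G. norm y \<le> r) \<and>
           (\<forall>f\<in>dual_space sE norm UNIV. (f \<longlongrightarrow> f x) G)
       \<longrightarrow> ((\<lambda>y. norm (P y - P x)) \<longlongrightarrow> 0) G)"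

definition weak_poly_space ::
  "nat \<Rightarrow> ('k::rc_field \<Rightarrow> 'e::real_normed_vector \<Rightarrow> 'e) \<Rightarrow> ('k \<Rightarrow> 'f::real_normed_vector \<Rightarrow> 'f) \<Rightarrow>
   ('e \<Rightarrow> 'f) set"
  where "weak_poly_space n sE sF =
    {P \<in> poly_space n sE sF. weakly_continuous_on_bounded_sets sE P}"

text \<open>The infimum of the empty set in \<^typ>\<open>enat\<close> is \<open>\<infinity>\<close>.\<close>

definition critical_degree ::
  "('k::rc_field \<Rightarrow> 'e::real_normed_vector \<Rightarrow> 'e) \<Rightarrow> ('k \<Rightarrow> 'f::real_normed_vector \<Rightarrow> 'f) \<Rightarrow> enat"
  where "critical_degree sE sF =
    Inf {enat k | k. k \<ge> 1 \<and> weak_poly_space k sE sF \<noteq> poly_space k sE sF}"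

definition compact_operator ::
  "('k::rc_field \<Rightarrow> 'e::real_normed_vector \<Rightarrow> 'e) \<Rightarrow> ('e \<Rightarrow> 'e) \<Rightarrow> bool"
  where "compact_operator s T \<longleftrightarrow>
    Vector_Spaces.linear s s T \<and> compact (closure (T ` cball 0 1))"

definition bounded_compact_net ::
  "('k::rc_field \<Rightarrow> 'e::real_normed_vector \<Rightarrow> 'e) \<Rightarrow> ('i \<Rightarrow> 'e \<Rightarrow> 'e) \<Rightarrow> bool"
  where "bounded_compact_net s T \<longleftrightarrow>
    (\<forall>i. compact_operator s (T i)) \<and> (\<exists>M. \<forall>i. onorm (T i) \<le> M)"

text \<open>
  The index set of a net is a directed preordered type; \<open>net_filter\<close> is the filter of its
  tails (for partial orders it is \<^term>\<open>at_top\<close>).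
\<close>

definition directed :: "'i::preorder itself \<Rightarrow> bool"
  where "directed _ \<longleftrightarrow> (\<forall>a b :: 'i. \<exists>c. a \<le> c \<and> b \<le> c)"

definition net_filter :: "'i::preorder filter"
  where "net_filter = (INF a. principal {a..})"

definition adjoint_map :: "('e \<Rightarrow> 'e) \<Rightarrow> ('e \<Rightarrow> 'k) \<Rightarrow> 'e \<Rightarrow> 'k"
  where "adjoint_map T f = f \<circ> T"

end

theory Submission
  imports Defs
begin

text \<open>
  Put \<open>X = P(n; E, F)\<close>, \<open>J = P\<^sub>w(n; E, F)\<close>, \<open>A P = L \<circ> P \<circ> K\<close> and \<open>B P = (Id - L) \<circ> P \<circ> (Id - K)\<close>, where
  \<open>K\<close> and \<open>L\<close> run through indices at which (2) and (3) hold with small \<open>\<epsilon>\<close>. Since \<open>p \<le> nq\<close>, the two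
  inequalities give \<open>\<parallel>A P + B Q\<parallel> \<le> (1 + \<epsilon>) max \<parallel>P\<parallel> \<parallel>Q\<parallel>\<close>. The operator \<open>A\<close> maps \<open>X\<close> into \<open>J\<close>;
  so does \<open>Id - B\<close>, because \<open>x \<mapsto> P x - P (x - y)\<close> has degree less than \<open>n = cd(E, F)\<close> and
  \<open>\<phi> \<circ> P\<close> has degree \<open>n < cd(E)\<close> for \<open>\<phi> \<in> F*\<close>. On \<open>J\<close>, weak (uniform) continuity gives \<open>A u \<longrightarrow> u\<close> and
  \<open>B u \<longrightarrow> 0\<close> in norm.

  Along an ultrafilter of indices put \<open>\<pi> f = lim f \<circ> A\<close> and \<open>\<beta> f = lim f \<circ> B\<close>. Then \<open>\<pi>\<close> is a projection
  with kernel the annihilator of \<open>J\<close>, on which \<open>\<beta>\<close> is the identity, and \<open>\<parallel>\<pi> f\<parallel> + \<parallel>\<beta> f\<parallel> \<le> \<parallel>f\<parallel>\<close>. Applied to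
  \<open>\<pi> f\<close> this inequality yields \<open>\<beta> (\<pi> f) = 0\<close>, hence \<open>\<beta> f = f - \<pi> f\<close>.
\<close>

section \<open>Functionals and ultrafilters\<close>

text \<open>Membership in J gives weak continuity at single points, while the convergence of A u to
  u compares x with K x, neither of which needs to converge weakly; so weak uniform continuity on
  balls must be proved, and balls of E need not be weakly compact. This is a second use of n = cd(E,
  F): translates of a polynomial differ from it by lower degrees, which allows an induction. Norm
  convergence of the adjoints at each functional is used in the form that x - K x tends weakly to 0
  uniformly on balls. L converges only pointwise, so it is tested on a compact set: u(K x) for one
  fixed K already approximates u on the ball. (2) and (3) hold only at arbitrarily late indices; the
  nets are therefore thinned to filters along which the estimates hold eventually, and an
  ultrafilter on pairs of indices replaces weak-star compactness of dual balls and makes the limits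
  linear. The sum inequality for \<pi> and \<beta> is dual to the maximum estimate: unimodular
  factors align the two values of f. The exponents enter through r = nq/p >= 1, for which t -> t^r
  is superadditive on t >= 0.\<close>

definition sublinear_functional :: "('a::real_vector \<Rightarrow> real) \<Rightarrow> bool"
  where "sublinear_functional p \<longleftrightarrow>
    (\<forall>x y. p (x + y) \<le> p x + p y) \<and> (\<forall>t\<ge>0. \<forall>x. p (t *\<^sub>R x) \<le> t * p x)"

lemma sublinear_functional_zero:
  assumes "sublinear_functional p"
  shows "p 0 = 0"
proof -
  have "p (0 *\<^sub>R 0) \<le> 0 * p 0" "p (0 + 0) \<le> p 0 + p 0"
    using assms unfolding sublinear_functional_def by blast+
  then show ?thesis by simp
qed

lemma sublinear_functional_neg_le:
  assumes "sublinear_functional p"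
  shows "- p (- x) \<le> p x"
proof -
  have "p (x + - x) \<le> p x + p (- x)"
    using assms unfolding sublinear_functional_def by blast
  then show ?thesis using sublinear_functional_zero[OF assms] by simp
qed

lemma sublinear_functional_scaleR:
  assumes p: "sublinear_functional p" and t: "t \<ge> 0"
  shows "p (t *\<^sub>R x) = t * p x"
proof (cases "t = 0")
  case True
  then show ?thesis using sublinear_functional_zero[OF p] by simp
next
  case False
  then have t0: "t > 0" using t by simp
  have "p ((1/t) *\<^sub>R (t *\<^sub>R x)) \<le> (1/t) * p (t *\<^sub>R x)"
    using p t0 unfolding sublinear_functional_def by (meson divide_nonneg_pos zero_le_one)
  then have "t * p x \<le> p (t *\<^sub>R x)" using t0 by (simp add: field_simps)
  moreover have "p (t *\<^sub>R x) \<le> t * p x"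
    using p t unfolding sublinear_functional_def by blast
  ultimately show ?thesis by simp
qed

text \<open>The largest sublinear functional below \<open>p\<close> whose value at
  \<open>- y\<close> is at most \<open>- p y\<close>: any such q satisfies q(x) <= q(x + t y) + t
  q(- y). A minimal \<open>p\<close> must equal it, which forces p(- y) = - p(y).\<close>

definition sublinear_shrink :: "('a::real_vector \<Rightarrow> real) \<Rightarrow> 'a \<Rightarrow> 'a \<Rightarrow> real"
  where "sublinear_shrink p y x = (INF t\<in>{0..}. p (x + t *\<^sub>R y) - t * p y)"

context
  fixes p :: "'a::real_vector \<Rightarrow> real" and y :: 'a
  assumes p: "sublinear_functional p"
begin

lemma sublinear_shrink_bdd: "bdd_below ((\<lambda>t. p (x + t *\<^sub>R y) - t * p y) ` {0..})"
proof (rule bdd_belowI2[where m = "- p (- x)"])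
  fix t :: real assume "t \<in> {0..}"
  then have "t * p y = p (t *\<^sub>R y)" using sublinear_functional_scaleR[OF p] by simp
  also have "\<dots> = p (- x + (x + t *\<^sub>R y))" by simp
  also have "\<dots> \<le> p (- x) + p (x + t *\<^sub>R y)"
    using p unfolding sublinear_functional_def by blast
  finally show "- p (- x) \<le> p (x + t *\<^sub>R y) - t * p y" by simp
qed

lemma sublinear_shrink_lower: "t \<ge> 0 \<Longrightarrow> sublinear_shrink p y x \<le> p (x + t *\<^sub>R y) - t * p y"
  unfolding sublinear_shrink_def by (rule cINF_lower[OF sublinear_shrink_bdd]) auto

lemma sublinear_shrink_greatest:
  "(\<And>t. t \<ge> 0 \<Longrightarrow> m \<le> p (x + t *\<^sub>R y) - t * p y) \<Longrightarrow> m \<le> sublinear_shrink p y x"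
  unfolding sublinear_shrink_def by (rule cINF_greatest) auto

lemma sublinear_shrink_le: "sublinear_shrink p y x \<le> p x"
  using sublinear_shrink_lower[of 0 x] by simp

lemma sublinear_shrink_neg: "sublinear_shrink p y (- y) \<le> - p y"
  using sublinear_shrink_lower[of 1 "- y"] sublinear_functional_zero[OF p] by simp

lemma sublinear_shrink_sublinear: "sublinear_functional (sublinear_shrink p y)"
  unfolding sublinear_functional_def
proof (intro conjI allI impI)
  fix x x' :: 'a
  have 1: "sublinear_shrink p y (x + x') - (p (x' + t' *\<^sub>R y) - t' * p y)
      \<le> p (x + t *\<^sub>R y) - t * p y" if "t \<ge> 0" "t' \<ge> 0" for t t'
  proof -
    have "sublinear_shrink p y (x + x') \<le> p (x + x' + (t + t') *\<^sub>R y) - (t + t') * p y"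
      using that by (intro sublinear_shrink_lower) auto
    also have "x + x' + (t + t') *\<^sub>R y = (x + t *\<^sub>R y) + (x' + t' *\<^sub>R y)"
      by (simp add: algebra_simps)
    also have "p \<dots> \<le> p (x + t *\<^sub>R y) + p (x' + t' *\<^sub>R y)"
      using p unfolding sublinear_functional_def by blast
    finally show ?thesis by (simp add: algebra_simps)
  qed
  have "sublinear_shrink p y (x + x') - sublinear_shrink p y x \<le> p (x' + t' *\<^sub>R y) - t' * p y"
    if "t' \<ge> 0" for t'
    using sublinear_shrink_greatest[of "sublinear_shrink p y (x + x') - (p (x' + t' *\<^sub>R y) - t' * p y)" x]
      1[OF _ that] by auto
  then show "sublinear_shrink p y (x + x') \<le> sublinear_shrink p y x + sublinear_shrink p y x'"
    using sublinear_shrink_greatest[of "sublinear_shrink p y (x + x') - sublinear_shrink p y x" x'] by auto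
next
  fix c :: real and x :: 'a
  assume c: "0 \<le> c"
  show "sublinear_shrink p y (c *\<^sub>R x) \<le> c * sublinear_shrink p y x"
  proof (cases "c = 0")
    case True
    then show ?thesis using sublinear_shrink_le[of 0] sublinear_functional_zero[OF p] by simp
  next
    case False
    then have c: "c > 0" using c by simp
    have "sublinear_shrink p y (c *\<^sub>R x) / c \<le> p (x + t *\<^sub>R y) - t * p y" if t: "t \<ge> 0" for t
    proof -
      have "sublinear_shrink p y (c *\<^sub>R x) \<le> p (c *\<^sub>R x + (c * t) *\<^sub>R y) - (c * t) * p y"
        using t c by (intro sublinear_shrink_lower) auto
      also have "c *\<^sub>R x + (c * t) *\<^sub>R y = c *\<^sub>R (x + t *\<^sub>R y)" by (simp add: algebra_simps)
      also have "p \<dots> = c * p (x + t *\<^sub>R y)" using c by (intro sublinear_functional_scaleR[OF p]) simp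
      finally show ?thesis using c by (simp add: field_simps)
    qed
    then have "sublinear_shrink p y (c *\<^sub>R x) / c \<le> sublinear_shrink p y x"
      by (rule sublinear_shrink_greatest)
    then show ?thesis using c by (simp add: field_simps)
  qed
qed

end

text \<open>Subadditivity of a pointwise infimum can fail for general families; in a chain, two
  members can be replaced by the smaller one, to which subadditivity applies. The common bound
  \<open>p0\<close> keeps the infimum finite, since - p0(- x) <= - p(- x) <= p(x).\<close>

lemma sublinear_functional_INF:
  fixes C :: "('a::real_vector \<Rightarrow> real) set"
  assumes C: "\<And>p. p \<in> C \<Longrightarrow> sublinear_functional p" "C \<noteq> {}"
    and below: "\<And>p. p \<in> C \<Longrightarrow> p \<le> p0"
    and chain: "\<And>p p'. p \<in> C \<Longrightarrow> p' \<in> C \<Longrightarrow> p \<le> p' \<or> p' \<le> p"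
  shows "sublinear_functional (\<lambda>x. INF p\<in>C. p x)" "\<And>p x. p \<in> C \<Longrightarrow> (INF p\<in>C. p x) \<le> p x"
proof -
  have bdd: "bdd_below ((\<lambda>p. p x) ` C)" for x
  proof (rule bdd_belowI2)
    fix p assume "p \<in> C"
    then show "- p0 (- x) \<le> p x"
      using sublinear_functional_neg_le[OF C(1), of p x] below[of p, THEN le_funD, of "- x"] by simp
  qed
  show lower: "(INF p\<in>C. p x) \<le> p x" if "p \<in> C" for p x
    by (rule cINF_lower[OF bdd that])
  show "sublinear_functional (\<lambda>x. INF p\<in>C. p x)"
    unfolding sublinear_functional_def
  proof (intro conjI allI impI)
    fix x y
    have 1: "(INF p\<in>C. p (x + y)) \<le> p x + p' y" if pC: "p \<in> C" "p' \<in> C" for p p'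
    proof -
      obtain q where q: "q \<in> C" "q \<le> p" "q \<le> p'"
        using chain[OF pC] pC by blast
      have "(INF p\<in>C. p (x + y)) \<le> q (x + y)" using q lower by blast
      also have "\<dots> \<le> q x + q y" using C(1)[OF q(1)] unfolding sublinear_functional_def by blast
      also have "\<dots> \<le> p x + p' y" using q by (intro add_mono) (auto dest: le_funD)
      finally show ?thesis .
    qed
    have "(INF p\<in>C. p (x + y)) - p' y \<le> (INF p\<in>C. p x)" if "p' \<in> C" for p'
      using 1[OF _ that] C(2) by (intro cINF_greatest) (auto simp: algebra_simps)
    then have "(INF p\<in>C. p (x + y)) - (INF p\<in>C. p x) \<le> (INF p\<in>C. p y)"
      using C(2) by (intro cINF_greatest) (auto simp: algebra_simps)
    then show "(INF p\<in>C. p (x + y)) \<le> (INF p\<in>C. p x) + (INF p\<in>C. p y)" by simp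
  next
    fix c :: real and x :: 'a
    assume c: "0 \<le> c"
    show "(INF p\<in>C. p (c *\<^sub>R x)) \<le> c * (INF p\<in>C. p x)"
    proof (cases "c = 0")
      case True
      have "p 0 = 0" if "p \<in> C" for p using C(1)[OF that] by (rule sublinear_functional_zero)
      then have "(INF p\<in>C. p 0) = (INF p\<in>C. 0)" by (intro INF_cong) auto
      then show ?thesis using True C(2) by simp
    next
      case False
      then have c: "c > 0" using c by simp
      have "(INF p\<in>C. p (c *\<^sub>R x)) / c \<le> (INF p\<in>C. p x)"
      proof (rule cINF_greatest[OF C(2)])
        fix p assume "p \<in> C"
        then have "(INF p\<in>C. p (c *\<^sub>R x)) \<le> c * p x"
          using lower[of p "c *\<^sub>R x"] sublinear_functional_scaleR[OF C(1), of p c x] c by simp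
        then show "(INF p\<in>C. p (c *\<^sub>R x)) / c \<le> p x" using c by (simp add: field_simps)
      qed
      then show ?thesis using c by (simp add: field_simps)
    qed
  qed
qed

text \<open>The sublinear functionals that are minimal for the pointwise order are exactly the linear ones.\<close>

lemma hahn_banach_sublinear:
  fixes p0 :: "'a::real_vector \<Rightarrow> real"
  assumes p0: "sublinear_functional p0"
  obtains l where "linear l" "\<And>x. l x \<le> p0 x"
proof -
  define S where "S = {p. sublinear_functional p \<and> p \<le> p0}"
  have "\<exists>m\<in>S. \<forall>a\<in>S. a \<le> m \<longrightarrow> a = m"
  proof (rule predicate_Zorn[of S "\<lambda>a b. b \<le> a", simplified])
    show "partial_order_on S (relation_of (\<lambda>a b. b \<le> a) S)"
      by (rule partial_order_on_relation_ofI) auto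
    fix C assume "C \<in> Chains (relation_of (\<lambda>a b. b \<le> a) S)"
    then have C: "C \<subseteq> S" "\<And>p p'. p \<in> C \<Longrightarrow> p' \<in> C \<Longrightarrow> p \<le> p' \<or> p' \<le> p"
      unfolding Chains_def relation_of_def by auto
    show "\<exists>u\<in>S. \<forall>a\<in>C. u \<le> a"
    proof (cases "C = {}")
      case True
      then show ?thesis using p0 unfolding S_def by auto
    next
      case False
      have 1: "sublinear_functional (\<lambda>x. INF p\<in>C. p x)" "\<And>p x. p \<in> C \<Longrightarrow> (INF p\<in>C. p x) \<le> p x"
        using sublinear_functional_INF[of C p0] C False unfolding S_def by blast+
      obtain p where p: "p \<in> C" using False by blast
      have "(\<lambda>x. INF p\<in>C. p x) \<le> p" using 1(2)[OF p] by (rule le_funI)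
      also have "p \<le> p0" using p C(1) unfolding S_def by blast
      finally have "(\<lambda>x. INF p\<in>C. p x) \<in> S" using 1(1) unfolding S_def by blast
      then show ?thesis using 1(2) by (meson le_funI)
    qed
  qed
  then obtain m where m: "sublinear_functional m" "m \<le> p0"
    and minimal: "\<And>a. sublinear_functional a \<Longrightarrow> a \<le> p0 \<Longrightarrow> a \<le> m \<Longrightarrow> a = m"
    unfolding S_def by blast
  \<comment> \<open>Minimality absorbs every shrink of \<open>m\<close>, so \<open>m\<close> is odd;
    an odd subadditive function is additive.\<close>
  have shrink: "sublinear_shrink m y = m" for y
  proof (rule minimal)
    show le: "sublinear_shrink m y \<le> m"
      using sublinear_shrink_le[OF m(1)] by (rule le_funI)
    show "sublinear_shrink m y \<le> p0" using le m(2) by (rule order_trans)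
  qed (rule sublinear_shrink_sublinear[OF m(1)])
  have neg: "m (- y) = - m y" for y
    using sublinear_shrink_neg[OF m(1), of y] shrink sublinear_functional_neg_le[OF m(1), of y] by simp
  have le: "m (x + y) \<le> m x + m y" for x y
    using m(1) unfolding sublinear_functional_def by blast
  have add: "m (x + y) = m x + m y" for x y
    using le[of x y] le[of "- x" "- y"] neg[of x] neg[of y] neg[of "x + y"] by simp
  have scale: "m (c *\<^sub>R x) = c * m x" for c x
  proof (cases "c \<ge> 0")
    case True
    then show ?thesis using sublinear_functional_scaleR[OF m(1)] by blast
  next
    case False
    then show ?thesis using sublinear_functional_scaleR[OF m(1), of "- c" x] neg[of "c *\<^sub>R x"] by simp
  qed
  show thesis
    by (rule that[of m]) (use m(2) in \<open>auto intro!: linearI simp: add scale le_fun_def\<close>)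
qed

text \<open>Shrinking the norm along \<open>z\<close> before applying Hahn-Banach builds l(- z) <= -
  norm z into the dominating functional; this replaces the extension of a functional from the line
  spanned by \<open>z\<close>.\<close>

lemma real_functional_nonzero:
  fixes z :: "'a::real_normed_vector"
  assumes "z \<noteq> 0"
  obtains l where "linear l" "\<And>x. l x \<le> norm x" "l z \<noteq> 0"
proof -
  have p: "sublinear_functional (norm :: 'a \<Rightarrow> real)"
    unfolding sublinear_functional_def by (auto intro: norm_triangle_ineq)
  obtain l where l: "linear l" "\<And>x. l x \<le> sublinear_shrink norm z x"
    using hahn_banach_sublinear[OF sublinear_shrink_sublinear[OF p]] by metis
  have "l (- z) \<le> - norm z"
    using l(2)[of "- z"] sublinear_shrink_neg[OF p, of z] by simp
  then have "l z \<noteq> 0" using assms linear_neg[OF l(1), of z] by auto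
  then show thesis
    using that[OF l(1)] l(2) sublinear_shrink_le[OF p] by (meson order_trans)
qed

section \<open>Scalar fields, and functionals over them that separate points\<close>

lemma rc_field_cases:
  obtains (real) "\<And>c :: 'k::rc_field. \<exists>r. c = of_real r"
  | (complex) i :: "'k::rc_field" where "i * i = -1" "\<And>c :: 'k. \<exists>a b. c = of_real a + of_real b * i"
proof -
  obtain \<phi> :: "'k \<Rightarrow> complex" where
    add: "\<And>a b. \<phi> (a + b) = \<phi> a + \<phi> b" and mult: "\<And>a b. \<phi> (a * b) = \<phi> a * \<phi> b"
    and scale: "\<And>r a. \<phi> (scaleR r a) = scaleR r (\<phi> a)" and nrm: "\<And>a. cmod (\<phi> a) = norm a"
    and rng: "range \<phi> = \<real> \<or> range \<phi> = UNIV"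
    using real_or_complex by blast
  have zero: "\<phi> 0 = 0" using nrm[of 0] by simp
  have diff: "\<phi> (a - b) = \<phi> a - \<phi> b" for a b
    using add[of "a - b" b] by simp
  have inj: "a = b" if "\<phi> a = \<phi> b" for a b
    using nrm[of "a - b"] that diff by simp
  \<comment> \<open>The value at 1 is an idempotent of modulus 1.\<close>
  have one: "\<phi> 1 = 1"
    using mult[of 1 1] nrm[of 1] by (metis mult_cancel_left1 norm_zero norm_one mult_1 zero_neq_one)
  have of_real: "\<phi> (of_real r) = of_real r" for r
    using scale[of r 1] one by (simp add: of_real_def)
  from rng show thesis
  proof
    assume R: "range \<phi> = \<real>"
    show thesis
    proof (rule real)
      fix c :: 'k
      have "\<phi> c \<in> \<real>" using R by auto
      then obtain r where "\<phi> c = of_real r" by (auto elim: Reals_cases)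
      then show "\<exists>r. c = of_real r" using inj of_real by metis
    qed
  next
    assume R: "range \<phi> = UNIV"
    then obtain i where i: "\<phi> i = \<i>" by (metis surjD)
    show thesis
    proof (rule complex)
      show "i * i = -1"
        by (rule inj) (use mult i one diff[of 0 1] zero in simp)
      fix c :: 'k
      have "\<phi> (of_real (Re (\<phi> c)) + of_real (Im (\<phi> c)) * i) = \<phi> c"
        by (simp add: add mult of_real i complex_eq_iff)
      then show "\<exists>a b. c = of_real a + of_real b * i" using inj by metis
    qed
  qed
qed

text \<open>Supplies limits of bounded scalar nets along ultrafilters. The isometry
  \<open>\<phi>\<close> identifies the ball with a bounded part of its range, which is closed in the
  complex plane in both cases.\<close>

lemma rc_field_compact_cball: "compact (cball (0::'k::rc_field) r)"
proof -
  obtain \<phi> :: "'k \<Rightarrow> complex" where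
    add: "\<And>a b. \<phi> (a + b) = \<phi> a + \<phi> b"
    and nrm: "\<And>a. cmod (\<phi> a) = norm a"
    and rng: "range \<phi> = \<real> \<or> range \<phi> = UNIV"
    using real_or_complex by blast
  have diff: "\<phi> (a - b) = \<phi> a - \<phi> b" for a b
    using add[of "a - b" b] by simp
  define \<psi> where "\<psi> = inv \<phi>"
  have nd: "norm (a - b) = cmod (\<phi> a - \<phi> b)" for a b
    using nrm[of "a - b"] diff by simp
  have inj: "inj \<phi>"
  proof (rule injI)
    fix x y assume "\<phi> x = \<phi> y"
    then show "x = y" using nd[of x y] by simp
  qed
  have "closed (range \<phi>)" using rng by (auto intro: closed_complex_Reals)
  then have comp: "compact (range \<phi> \<inter> cball 0 r)"
    by (rule closed_Int_compact) simp
  have "continuous_on (range \<phi>) \<psi>"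
    unfolding continuous_on_iff
    by (auto simp: \<psi>_def inv_f_f[OF inj] dist_norm nd intro!: exI)
  then have "continuous_on (range \<phi> \<inter> cball 0 r) \<psi>" by (rule continuous_on_subset) auto
  then have "compact (\<psi> ` (range \<phi> \<inter> cball 0 r))" using comp by (rule compact_continuous_image)
  also have "\<psi> ` (range \<phi> \<inter> cball 0 r) = cball 0 r"
    by (force simp: \<psi>_def inv_f_f[OF inj] nrm image_iff)
  finally show ?thesis .
qed

lemma banach_over_functional_nonzero:
  fixes s :: "'k::rc_field \<Rightarrow> 'e::banach \<Rightarrow> 'e"
  assumes s: "banach_over s" and z: "z \<noteq> 0"
  obtains f where "f \<in> dual_space s norm UNIV" "f z \<noteq> 0"
proof -
  interpret banach_over s by fact
  obtain l :: "'e \<Rightarrow> real" where l: "linear l" "\<And>x. l x \<le> norm x" and lz: "l z \<noteq> 0"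
    using real_functional_nonzero[OF z] by blast
  have l_add: "l (x + y) = l x + l y" for x y using linear_add[OF l(1)] .
  have l_scale: "l (r *\<^sub>R x) = r * l x" for r x using linear_scale[OF l(1), of r x] by simp
  have l_abs: "\<bar>l x\<bar> \<le> norm x" for x
    using l(2)[of x] l(2)[of "- x"] linear_neg[OF l(1), of x] by simp
  show thesis
  proof (cases rule: rc_field_cases[where 'k = 'k])
    case real
    define f :: "'e \<Rightarrow> 'k" where "f = (\<lambda>x. of_real (l x))"
    have "f (s c x) = c * f x" for c x
    proof -
      obtain r where "c = of_real r" using real by blast
      then show ?thesis by (simp add: f_def scale_of_real l_scale)
    qed
    then have "f \<in> dual_space s norm UNIV"
      unfolding dual_space_def using l_abs by (auto simp: f_def l_add intro!: exI[of _ 1])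
    then show thesis using that[of f] lz by (simp add: f_def)
  next
    case (complex i)
    \<comment> \<open>The usual complexification: \<open>l\<close> is the real part, and the second
      term makes \<open>f\<close> commute with multiplication by \<open>i\<close>.\<close>
    define f :: "'e \<Rightarrow> 'k" where "f = (\<lambda>x. of_real (l x) - i * of_real (l (s i x)))"
    have fadd: "f (x + y) = f x + f y" for x y
      by (simp add: f_def l_add scale_right_distrib distrib_left)
    have si: "s i (r *\<^sub>R x) = r *\<^sub>R s i x" for r x
      using scale_left_commute[of i "of_real r" x] by (simp only: scale_of_real)
    have fr: "f (s (of_real r) x) = of_real r * f x" for r x
      by (simp add: f_def scale_of_real si l_scale algebra_simps)
    have ii: "s i (s i x) = - x" for x
      using complex(1) by simp
    have fi: "f (s i x) = i * f x" for x
      using complex(1) by (simp add: f_def ii linear_neg[OF l(1)] algebra_simps flip: mult.assoc)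
    have fs: "f (s c x) = c * f x" for c x
    proof -
      obtain a b where c: "c = of_real a + of_real b * i" using complex(2) by blast
      have "s c x = s (of_real a) x + s (of_real b) (s i x)"
        by (simp add: c scale_left_distrib)
      then have "f (s c x) = of_real a * f x + of_real b * (i * f x)"
        by (simp only: fadd fr fi)
      then show ?thesis by (simp add: c algebra_simps)
    qed
    have "norm (i * i) = 1" using complex(1) by simp
    then have "norm i ^ 2 = 1" by (simp add: norm_mult power2_eq_square)
    then have ni: "norm i = 1" using norm_ge_zero[of i] by (simp add: power2_eq_1_iff)
    have "norm (f x) \<le> 2 * norm x" for x
    proof -
      have "norm (f x) \<le> \<bar>l x\<bar> + \<bar>l (s i x)\<bar>"
        unfolding f_def by (rule order_trans[OF norm_triangle_ineq4]) (simp add: norm_mult ni)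
      also have "\<dots> \<le> norm x + norm (s i x)" using l_abs by (intro add_mono)
      finally show ?thesis by (simp add: norm_scale ni)
    qed
    then have "f \<in> dual_space s norm UNIV"
      unfolding dual_space_def using fadd fs by auto
    moreover have "f z \<noteq> 0"
    proof
      assume f0: "f z = 0"
      then have e: "of_real (l z) = i * (of_real (l (s i z)) :: 'k)" by (simp add: f_def)
      \<comment> \<open>The abstract field offers no real parts to compare; squaring l(z) = i l(i z)
        instead makes a real square equal to minus a real square.\<close>
      then have "of_real (l z * l z) = (i * i) * (of_real (l (s i z) * l (s i z)) :: 'k)"
        by (simp add: algebra_simps)
      then have "(of_real (l z * l z) :: 'k) = of_real (- (l (s i z) * l (s i z)))"
        by (simp add: complex(1))
      then have "l z * l z = - (l (s i z) * l (s i z))" by (simp only: of_real_eq_iff)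
      then show False using lz by (smt (verit) not_real_square_gt_zero zero_le_square)
    qed
    ultimately show thesis using that by blast
  qed
qed

section \<open>Ultrafilters and limits along them\<close>

lemma ultrafilter_refinement:
  fixes F :: "'a filter"
  assumes "F \<noteq> bot"
  obtains U where "U \<noteq> bot" "U \<le> F" "\<And>P. eventually P U \<or> eventually (\<lambda>x. \<not> P x) U"
proof -
  define S where "S = {G. G \<noteq> bot \<and> G \<le> F}"
  have "\<exists>m\<in>S. \<forall>a\<in>S. a \<le> m \<longrightarrow> a = m"
  proof (rule predicate_Zorn[of S "\<lambda>a b. b \<le> a", simplified])
    show "partial_order_on S (relation_of (\<lambda>a b. b \<le> a) S)"
      by (rule partial_order_on_relation_ofI) auto
    fix C assume "C \<in> Chains (relation_of (\<lambda>a b. b \<le> a) S)"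
    then have C: "C \<subseteq> S" "\<And>p p'. p \<in> C \<Longrightarrow> p' \<in> C \<Longrightarrow> p \<le> p' \<or> p' \<le> p"
      unfolding Chains_def relation_of_def by auto
    show "\<exists>u\<in>S. \<forall>a\<in>C. u \<le> a"
    proof (cases "C = {}")
      case True
      then show ?thesis using assms unfolding S_def by auto
    next
      case False
      \<comment> \<open>A chain is a filter base, so an event of the infimum already belongs to one
        member; hence properness passes to the infimum.\<close>
      have "eventually P (Inf C) \<longleftrightarrow> (\<exists>b\<in>C. eventually P b)" for P
        by (intro eventually_Inf_base[OF False]) (use C(2) in \<open>force simp: le_inf_iff\<close>)
      then have "Inf C \<noteq> bot"
        using C(1) unfolding trivial_limit_def S_def by blast
      moreover have "Inf C \<le> F"
      proof -
        obtain G where G: "G \<in> C" using False by blast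
        then have "G \<le> F" using C(1) unfolding S_def by blast
        then show ?thesis using G by (rule Inf_lower2[rotated])
      qed
      ultimately have "Inf C \<in> S" unfolding S_def by blast
      then show ?thesis by (intro bexI[of _ "Inf C"]) (auto intro: Inf_lower)
    qed
  qed
  then obtain U where U: "U \<noteq> bot" "U \<le> F"
    and minimal: "\<And>a. a \<noteq> bot \<Longrightarrow> a \<le> F \<Longrightarrow> a \<le> U \<Longrightarrow> a = U"
    unfolding S_def by blast
  show thesis
  proof (rule that[OF U])
    fix P
    \<comment> \<open>Restricting \<open>U\<close> to \<open>P\<close> either gives the trivial
      filter, and then the complement holds eventually, or gives back \<open>U\<close> by
      minimality.\<close>
    show "eventually P U \<or> eventually (\<lambda>x. \<not> P x) U"
    proof (cases "inf U (principal {x. P x}) = bot")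
      case True
      then show ?thesis by (auto simp: trivial_limit_def eventually_inf_principal)
    next
      case False
      then have "inf U (principal {x. P x}) = U"
        using minimal[of "inf U (principal {x. P x})"] U(2) by (meson inf.coboundedI1 inf_le1)
      then have "U \<le> principal {x. P x}" by (metis inf_le2)
      then show ?thesis by (simp add: le_principal)
    qed
  qed
qed

text \<open>Compactness supplies a cluster point, and along an ultrafilter a cluster point is a
  limit: an event that is not eventual has an eventual complement.\<close>

lemma ultrafilter_limit:
  fixes g :: "'a \<Rightarrow> 'b::topological_space"
  assumes U: "U \<noteq> bot" "\<And>P. eventually P U \<or> eventually (\<lambda>x. \<not> P x) U"
    and S: "compact S" and g: "eventually (\<lambda>x. g x \<in> S) U"
  shows "\<exists>l. (g \<longlongrightarrow> l) U"
proof -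
  have "filtermap g U \<noteq> bot" "eventually (\<lambda>y. y \<in> S) (filtermap g U)"
    using U(1) g by (auto simp: filtermap_bot_iff eventually_filtermap)
  then obtain l where l: "l \<in> S" "inf (nhds l) (filtermap g U) \<noteq> bot"
    using S unfolding compact_filter by blast
  have "(g \<longlongrightarrow> l) U"
  proof (rule topological_tendstoI)
    fix T assume T: "open T" "l \<in> T"
    show "eventually (\<lambda>x. g x \<in> T) U"
    proof (rule ccontr)
      assume "\<not> ?thesis"
      then have "eventually (\<lambda>x. g x \<notin> T) U" using U(2) by blast
      then have "eventually (\<lambda>y. y \<notin> T) (filtermap g U)" by (simp add: eventually_filtermap)
      moreover have "eventually (\<lambda>y. y \<in> T) (nhds l)" using T by (auto simp: eventually_nhds)
      ultimately have "eventually (\<lambda>_. False) (inf (nhds l) (filtermap g U))"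
        unfolding eventually_inf by (intro exI conjI) auto
      then show False using l(2) by (simp add: trivial_limit_def)
    qed
  qed
  then show ?thesis ..
qed

section \<open>M-ideals from approximating operators\<close>

text \<open>The axioms are restricted to \<open>X\<close> because the intended \<open>N\<close> is
  \<open>poly_norm\<close>, a supremum that is meaningful only for functions bounded on the unit
  ball.\<close>

locale seminormed_carrier = vector_space s
  for s :: "'k::rc_field \<Rightarrow> 'v::ab_group_add \<Rightarrow> 'v" +
  fixes N :: "'v \<Rightarrow> real" and X :: "'v set"
  assumes X: "subspace X"
    and N_nonneg: "\<And>v. v \<in> X \<Longrightarrow> 0 \<le> N v"
    and N_scale: "\<And>c v. v \<in> X \<Longrightarrow> N (s c v) = norm c * N v"
begin

lemma N_zero: "N 0 = 0"
  using N_scale[of 0 0] subspace_0[OF X] by simp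

lemma dualD:
  assumes "f \<in> dual_space s N X"
  shows "u \<in> X \<Longrightarrow> v \<in> X \<Longrightarrow> f (u + v) = f u + f v" "v \<in> X \<Longrightarrow> f (s c v) = c * f v"
    "v \<notin> X \<Longrightarrow> f v = 0"
  using assms unfolding dual_space_def by blast+

lemma dualI:
  assumes "\<And>u v. u \<in> X \<Longrightarrow> v \<in> X \<Longrightarrow> f (u + v) = f u + f v"
    and "\<And>c v. v \<in> X \<Longrightarrow> f (s c v) = c * f v"
    and "\<And>v. v \<in> X \<Longrightarrow> norm (f v) \<le> C * N v" and "\<And>v. v \<notin> X \<Longrightarrow> f v = 0"
  shows "f \<in> dual_space s N X"
  using assms unfolding dual_space_def by blast

lemma dual_bound:
  assumes "f \<in> dual_space s N X"
  obtains C where "C \<ge> 0" "\<And>v. v \<in> X \<Longrightarrow> norm (f v) \<le> C * N v"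
proof -
  obtain C where C: "\<And>v. v \<in> X \<Longrightarrow> norm (f v) \<le> C * N v"
    using assms unfolding dual_space_def by blast
  have "norm (f v) \<le> max C 0 * N v" if "v \<in> X" for v
    by (rule order_trans[OF C[OF that]]) (use N_nonneg[OF that] in \<open>auto intro: mult_right_mono\<close>)
  then show thesis using that[of "max C 0"] by auto
qed

lemma dual_diff_arg:
  assumes "f \<in> dual_space s N X" "u \<in> X" "v \<in> X"
  shows "f (u - v) = f u - f v"
  using dualD(1)[OF assms(1), of "u - v" v] subspace_diff[OF X] assms by simp

lemma dual_norm_bdd:
  assumes "f \<in> dual_space s N X"
  shows "bdd_above ((\<lambda>v. norm (f v)) ` {v \<in> X. N v \<le> 1})"
proof -
  obtain C where C: "C \<ge> 0" "\<And>v. v \<in> X \<Longrightarrow> norm (f v) \<le> C * N v"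
    using dual_bound[OF assms] by blast
  have "norm (f v) \<le> C * 1" if "v \<in> X" "N v \<le> 1" for v
    using C(2)[OF that(1)] mult_left_mono[OF that(2) C(1)] by linarith
  then show ?thesis by (intro bdd_aboveI2[where M = "C * 1"]) auto
qed

lemma norm_le_dual_norm:
  assumes "f \<in> dual_space s N X" "v \<in> X" "N v \<le> 1"
  shows "norm (f v) \<le> dual_norm N X f"
  unfolding dual_norm_def using assms(2,3) by (intro cSUP_upper dual_norm_bdd[OF assms(1)]) auto

lemma dual_norm_least:
  assumes "\<And>v. v \<in> X \<Longrightarrow> N v \<le> 1 \<Longrightarrow> norm (f v) \<le> c"
  shows "dual_norm N X f \<le> c"
  unfolding dual_norm_def using assms subspace_0[OF X] N_zero by (intro cSUP_least) auto

lemma dual_norm_nonneg: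
  assumes "f \<in> dual_space s N X"
  shows "0 \<le> dual_norm N X f"
  using norm_le_dual_norm[OF assms subspace_0[OF X]] N_zero norm_ge_zero[of "f 0"] by linarith

lemma norm_le_dual_norm_times:
  assumes f: "f \<in> dual_space s N X" and v: "v \<in> X"
  shows "norm (f v) \<le> dual_norm N X f * N v"
proof (cases "N v = 0")
  case True
  \<comment> \<open>A vector of seminorm 0 cannot be normalized; boundedness forces \<open>f\<close>
    to vanish there.\<close>
  obtain C where "norm (f v) \<le> C * N v" using dual_bound[OF f] v by metis
  then show ?thesis using True by simp
next
  case False
  then have Nv: "N v > 0" using N_nonneg[OF v] by simp
  let ?w = "s (of_real (1 / N v)) v"
  have "?w \<in> X" using subspace_scale[OF X v] .
  moreover have "N ?w \<le> 1" using N_scale[OF v] Nv by (simp add: norm_divide)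
  ultimately have "norm (f ?w) \<le> dual_norm N X f" by (rule norm_le_dual_norm[OF f])
  then show ?thesis using dualD(2)[OF f v] Nv by (simp add: norm_mult norm_divide field_simps)
qed

lemma dual_add: "f \<in> dual_space s N X \<Longrightarrow> g \<in> dual_space s N X \<Longrightarrow> f + g \<in> dual_space s N X"
proof -
  assume f: "f \<in> dual_space s N X" and g: "g \<in> dual_space s N X"
  obtain C where C: "\<And>v. v \<in> X \<Longrightarrow> norm (f v) \<le> C * N v" using dual_bound[OF f] by blast
  obtain D where D: "\<And>v. v \<in> X \<Longrightarrow> norm (g v) \<le> D * N v" using dual_bound[OF g] by blast
  show ?thesis
  proof (rule dualI)
    show "norm ((f + g) v) \<le> (C + D) * N v" if "v \<in> X" for v
      using norm_triangle_ineq[of "f v" "g v"] C[OF that] D[OF that] by (simp add: distrib_right)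
  qed (simp_all add: dualD[OF f] dualD[OF g] algebra_simps)
qed

lemma dual_scale: "f \<in> dual_space s N X \<Longrightarrow> (\<lambda>v. c * f v) \<in> dual_space s N X"
proof -
  assume f: "f \<in> dual_space s N X"
  obtain C where C: "\<And>v. v \<in> X \<Longrightarrow> norm (f v) \<le> C * N v" using dual_bound[OF f] by blast
  show ?thesis
  proof (rule dualI)
    show "norm (c * f v) \<le> (norm c * C) * N v" if "v \<in> X" for v
      using mult_left_mono[OF C[OF that], of "norm c"] by (simp add: norm_mult mult.assoc)
  qed (simp_all add: dualD[OF f] algebra_simps)
qed

lemma dual_minus: "f \<in> dual_space s N X \<Longrightarrow> g \<in> dual_space s N X \<Longrightarrow> f - g \<in> dual_space s N X"
  using dual_add[of f "\<lambda>v. -1 * g v"] dual_scale[of g "-1"] by (simp add: plus_fun_def fun_diff_def)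

lemma dual_norm_triangle:
  assumes f: "f \<in> dual_space s N X" and g: "g \<in> dual_space s N X"
  shows "dual_norm N X (f + g) \<le> dual_norm N X f + dual_norm N X g"
proof (rule dual_norm_least)
  fix v assume v: "v \<in> X" "N v \<le> 1"
  show "norm ((f + g) v) \<le> dual_norm N X f + dual_norm N X g"
    using norm_triangle_ineq[of "f v" "g v"] norm_le_dual_norm[OF f v] norm_le_dual_norm[OF g v] by simp
qed

end

lemma rc_field_unimodular:
  fixes z :: "'k::rc_field"
  obtains c where "norm c = 1" "c * z = of_real (norm z)"
proof (cases "z = 0")
  case True
  then show thesis using that[of 1] by simp
next
  case False
  then show thesis using that[of "of_real (norm z) / z"] by (simp add: norm_divide)
qed

text \<open>
  The operators \<open>A\<close> approximate the identity of the subspace \<open>J\<close>, and the operators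
  \<open>B\<close> approximate the identity of the quotient by \<open>J\<close>.
\<close>

locale M_ideal_approximation = seminormed_carrier s N X
  for s :: "'k::rc_field \<Rightarrow> 'v::ab_group_add \<Rightarrow> 'v" and N X +
  fixes J :: "'v set" and A B :: "'g \<Rightarrow> 'v \<Rightarrow> 'v" and U :: "'g filter"
  assumes J: "subspace J" "J \<subseteq> X"
    and J_closed: "\<And>v. v \<in> X \<Longrightarrow> (\<And>e. e > 0 \<Longrightarrow> \<exists>u\<in>J. N (v - u) < e) \<Longrightarrow> v \<in> J"
    and A_add: "\<And>g u v. u \<in> X \<Longrightarrow> v \<in> X \<Longrightarrow> A g (u + v) = A g u + A g v"
    and A_scale: "\<And>g c v. v \<in> X \<Longrightarrow> A g (s c v) = s c (A g v)"
    and B_add: "\<And>g u v. u \<in> X \<Longrightarrow> v \<in> X \<Longrightarrow> B g (u + v) = B g u + B g v"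
    and B_scale: "\<And>g c v. v \<in> X \<Longrightarrow> B g (s c v) = s c (B g v)"
    and A_in: "\<And>g v. v \<in> X \<Longrightarrow> A g v \<in> J"
    and B_in: "\<And>g v. v \<in> X \<Longrightarrow> v - B g v \<in> J"
    and U: "U \<noteq> bot" "\<And>P. eventually P U \<or> eventually (\<lambda>x. \<not> P x) U"
    and A_lim: "\<And>u. u \<in> J \<Longrightarrow> ((\<lambda>g. N (A g u - u)) \<longlongrightarrow> 0) U"
    and B_lim: "\<And>u. u \<in> J \<Longrightarrow> ((\<lambda>g. N (B g u)) \<longlongrightarrow> 0) U"
    and AB_le: "\<And>e. e > 0 \<Longrightarrow>
      \<forall>\<^sub>F g in U. \<forall>u\<in>X. \<forall>v\<in>X. N (A g u + B g v) \<le> (1 + e) * max (N u) (N v)"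
begin

abbreviation "dual \<equiv> dual_space s N X"

lemma A_X: "v \<in> X \<Longrightarrow> A g v \<in> X"
  using A_in J by blast

lemma B_X: "v \<in> X \<Longrightarrow> B g v \<in> X"
proof -
  assume v: "v \<in> X"
  have "v - (v - B g v) \<in> X"
    using subspace_diff[OF X v] B_in[OF v] J by blast
  then show ?thesis by simp
qed

lemma A_zero: "A g 0 = 0"
  using A_scale[of 0 g 0] subspace_0[OF X] by simp

lemma B_zero: "B g 0 = 0"
  using B_scale[of 0 g 0] subspace_0[OF X] by simp

text \<open>Setting one argument of the joint estimate to 0 bounds the other operator; e = 1
  produces the constant 2.\<close>

lemma A_bound: "\<forall>\<^sub>F g in U. \<forall>v\<in>X. N (A g v) \<le> 2 * N v"
proof (rule eventually_mono[OF AB_le[of 1]])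
  fix g assume *: "\<forall>u\<in>X. \<forall>v\<in>X. N (A g u + B g v) \<le> (1 + 1) * max (N u) (N v)"
  show "\<forall>v\<in>X. N (A g v) \<le> 2 * N v"
    using *[rule_format, OF _ subspace_0[OF X]] N_nonneg by (auto simp: B_zero N_zero)
qed simp

lemma B_bound: "\<forall>\<^sub>F g in U. \<forall>v\<in>X. N (B g v) \<le> 2 * N v"
proof (rule eventually_mono[OF AB_le[of 1]])
  fix g assume *: "\<forall>u\<in>X. \<forall>v\<in>X. N (A g u + B g v) \<le> (1 + 1) * max (N u) (N v)"
  show "\<forall>v\<in>X. N (B g v) \<le> 2 * N v"
    using *[rule_format, OF subspace_0[OF X]] N_nonneg by (auto simp: A_zero N_zero)
qed simp

text \<open>\<open>ulim A\<close> and \<open>ulim B\<close> are the maps \<pi> and \<beta> of the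
  overview. The value 0 outside \<open>X\<close> is the extension convention of
  \<open>dual_space\<close>.\<close>

definition ulim :: "('g \<Rightarrow> 'v \<Rightarrow> 'v) \<Rightarrow> ('v \<Rightarrow> 'k) \<Rightarrow> 'v \<Rightarrow> 'k"
  where "ulim T f v = (if v \<in> X then Lim U (\<lambda>g. f (T g v)) else 0)"

text \<open>The values f(T v) eventually stay in a closed ball of the scalars, which is compact, so
  that \<open>Lim\<close> is a genuine limit.\<close>

lemma ulim_tendsto:
  assumes TX: "\<forall>g. \<forall>v\<in>X. T g v \<in> X" and T: "\<forall>\<^sub>F g in U. \<forall>v\<in>X. N (T g v) \<le> 2 * N v"
    and f: "f \<in> dual" and v: "v \<in> X"
  shows "((\<lambda>g. f (T g v)) \<longlongrightarrow> ulim T f v) U"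
    and "norm (ulim T f v) \<le> dual_norm N X f * 2 * N v"
proof -
  have TXD: "v \<in> X \<Longrightarrow> T g v \<in> X" for g v using TX by blast
  have ev: "\<forall>\<^sub>F g in U. norm (f (T g v)) \<le> dual_norm N X f * 2 * N v"
  proof (rule eventually_mono[OF T])
    fix g assume "\<forall>v\<in>X. N (T g v) \<le> 2 * N v"
    then have "N (T g v) \<le> 2 * N v" using v by blast
    then show "norm (f (T g v)) \<le> dual_norm N X f * 2 * N v"
      using norm_le_dual_norm_times[OF f TXD[OF v], of g] mult_left_mono[OF _ dual_norm_nonneg[OF f]]
      by (metis mult.assoc order_trans)
  qed
  obtain l where l: "((\<lambda>g. f (T g v)) \<longlongrightarrow> l) U"
    using ultrafilter_limit[OF U rc_field_compact_cball[of "dual_norm N X f * 2 * N v"],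
        of "\<lambda>g. f (T g v)"] ev by auto
  then show lim: "((\<lambda>g. f (T g v)) \<longlongrightarrow> ulim T f v) U"
    using tendsto_Lim[OF U(1) l] v by (simp add: ulim_def)
  show "norm (ulim T f v) \<le> dual_norm N X f * 2 * N v"
    by (rule tendsto_upperbound[OF tendsto_norm[OF lim] ev U(1)])
qed

lemma
  assumes "f \<in> dual" "v \<in> X"
  shows ulim_A: "((\<lambda>g. f (A g v)) \<longlongrightarrow> ulim A f v) U"
    and ulim_B: "((\<lambda>g. f (B g v)) \<longlongrightarrow> ulim B f v) U"
  using assms A_X B_X by (auto intro: ulim_tendsto[OF _ A_bound] ulim_tendsto[OF _ B_bound])

lemma ulim_dual:
  assumes TX: "\<forall>g. \<forall>v\<in>X. T g v \<in> X" and T: "\<forall>\<^sub>F g in U. \<forall>v\<in>X. N (T g v) \<le> 2 * N v"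
    and add: "\<And>g u v. u \<in> X \<Longrightarrow> v \<in> X \<Longrightarrow> T g (u + v) = T g u + T g v"
    and scale: "\<And>g c v. v \<in> X \<Longrightarrow> T g (s c v) = s c (T g v)"
    and f: "f \<in> dual"
  shows "ulim T f \<in> dual"
proof -
  have TXD: "v \<in> X \<Longrightarrow> T g v \<in> X" for g v using TX by blast
  note lim = ulim_tendsto(1)[OF TX T f]
  show ?thesis
  proof (rule dualI)
    fix u v assume uv: "u \<in> X" "v \<in> X"
    show "ulim T f (u + v) = ulim T f u + ulim T f v"
    proof (rule tendsto_unique[OF U(1) lim[OF subspace_add[OF X uv]]])
      show "((\<lambda>g. f (T g (u + v))) \<longlongrightarrow> ulim T f u + ulim T f v) U"
        using tendsto_add[OF lim[OF uv(1)] lim[OF uv(2)]]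
        by (simp add: add[OF uv] dualD(1)[OF f TXD[OF uv(1)] TXD[OF uv(2)]])
    qed
  next
    fix c v assume v: "v \<in> X"
    show "ulim T f (s c v) = c * ulim T f v"
    proof (rule tendsto_unique[OF U(1) lim[OF subspace_scale[OF X v]]])
      show "((\<lambda>g. f (T g (s c v))) \<longlongrightarrow> c * ulim T f v) U"
        using tendsto_mult_left[OF lim[OF v], of c]
        by (simp add: scale[OF v] dualD(2)[OF f TXD[OF v]])
    qed
    show "norm (ulim T f v) \<le> dual_norm N X f * 2 * N v"
      using ulim_tendsto(2)[OF TX T f v] .
  qed (simp add: ulim_def)
qed

lemma ulim_dual_A: "f \<in> dual \<Longrightarrow> ulim A f \<in> dual"
  by (rule ulim_dual[OF _ A_bound]) (auto simp: A_X A_add A_scale)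

lemma ulim_dual_B: "f \<in> dual \<Longrightarrow> ulim B f \<in> dual"
  by (rule ulim_dual[OF _ B_bound]) (auto simp: B_X B_add B_scale)

lemma dual_eqI: "f \<in> dual \<Longrightarrow> g \<in> dual \<Longrightarrow> (\<And>v. v \<in> X \<Longrightarrow> f v = g v) \<Longrightarrow> f = g"
  by (rule ext) (metis dualD(3))

lemma ulim_A_J:
  assumes f: "f \<in> dual" and u: "u \<in> J"
  shows "ulim A f u = f u"
proof -
  have uX: "u \<in> X" using u J by blast
  have "((\<lambda>g. dual_norm N X f * N (A g u - u)) \<longlongrightarrow> dual_norm N X f * 0) U"
    by (intro tendsto_mult_left A_lim u)
  then have 0: "((\<lambda>g. dual_norm N X f * N (A g u - u)) \<longlongrightarrow> 0) U" by simp
  have "((\<lambda>g. f (A g u - u)) \<longlongrightarrow> 0) U"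
    by (rule Lim_null_comparison[OF _ 0])
      (simp add: norm_le_dual_norm_times[OF f subspace_diff[OF X A_X[OF uX] uX]])
  then have "((\<lambda>g. f (A g u)) \<longlongrightarrow> f u) U"
    by (simp add: dual_diff_arg[OF f A_X[OF uX] uX] LIM_zero_iff)
  then show ?thesis using tendsto_unique[OF U(1) ulim_A[OF f uX]] uX by blast
qed

lemma ulim_A_annihilator:
  assumes f: "f \<in> dual" and "\<And>u. u \<in> J \<Longrightarrow> f u = 0"
  shows "ulim A f = 0"
proof (rule ext)
  fix v
  show "ulim A f v = 0 v"
  proof (cases "v \<in> X")
    case True
    have "f (A g v) = 0" for g using assms(2) A_in[OF True] by blast
    then show ?thesis using tendsto_Lim[OF U(1), of "\<lambda>_. 0" 0] True by (simp add: ulim_def)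
  qed (simp add: ulim_def)
qed

lemma ulim_B_annihilator:
  assumes f: "f \<in> dual" and "\<And>u. u \<in> J \<Longrightarrow> f u = 0"
  shows "ulim B f = f"
proof (rule dual_eqI[OF ulim_dual_B[OF f] f])
  fix v assume v: "v \<in> X"
  have "f (v - B g v) = 0" for g using assms(2) B_in[OF v] by blast
  then have "f (B g v) = f v" for g using dual_diff_arg[OF f v B_X[OF v], of g] by simp
  then show "ulim B f v = f v" using tendsto_Lim[OF U(1), of "\<lambda>_. f v" "f v"] v by (simp add: ulim_def)
qed

lemma ulim_A_add:
  assumes "f \<in> dual" "g \<in> dual"
  shows "ulim A (f + g) = ulim A f + ulim A g"
proof (rule dual_eqI)
  fix v assume v: "v \<in> X"
  show "ulim A (f + g) v = (ulim A f + ulim A g) v"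
    using tendsto_unique[OF U(1) ulim_A[OF dual_add[OF assms] v]
        tendsto_add[OF ulim_A[OF assms(1) v] ulim_A[OF assms(2) v], folded plus_fun_apply]] v
    by simp
qed (use assms in \<open>auto intro!: ulim_dual_A dual_add\<close>)

lemma ulim_B_add:
  assumes "f \<in> dual" "g \<in> dual"
  shows "ulim B (f + g) = ulim B f + ulim B g"
proof (rule dual_eqI)
  fix v assume v: "v \<in> X"
  show "ulim B (f + g) v = (ulim B f + ulim B g) v"
    using tendsto_unique[OF U(1) ulim_B[OF dual_add[OF assms] v]
        tendsto_add[OF ulim_B[OF assms(1) v] ulim_B[OF assms(2) v], folded plus_fun_apply]] v
    by simp
qed (use assms in \<open>auto intro!: ulim_dual_B dual_add\<close>)

lemma ulim_A_scale:
  assumes f: "f \<in> dual"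
  shows "ulim A (\<lambda>v. c * f v) = (\<lambda>v. c * ulim A f v)"
proof (rule dual_eqI)
  fix v assume v: "v \<in> X"
  show "ulim A (\<lambda>v. c * f v) v = c * ulim A f v"
    using tendsto_unique[OF U(1) ulim_A[OF dual_scale[OF f] v]
        tendsto_mult_left[OF ulim_A[OF f v]]] v
    by simp
qed (use f in \<open>auto intro!: ulim_dual_A dual_scale\<close>)

text \<open>Dual form of the maximum estimate for A u + B v. Unimodular factors rotate both limits
  onto the nonnegative real axis, so the sum of their moduli is the limit of |f| at single vectors
  of norm at most 1 + e.\<close>

lemma ulim_norm_add_le:
  assumes f: "f \<in> dual"
  shows "dual_norm N X (ulim A f) + dual_norm N X (ulim B f) \<le> dual_norm N X f"
proof -
  have le: "norm (ulim A f u) + norm (ulim B f v) \<le> dual_norm N X f"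
    if u: "u \<in> X" "N u \<le> 1" and v: "v \<in> X" "N v \<le> 1" for u v
  proof -
    obtain c where c: "norm c = 1" "c * ulim A f u = of_real (norm (ulim A f u))"
      using rc_field_unimodular by blast
    obtain d where d: "norm d = 1" "d * ulim B f v = of_real (norm (ulim B f v))"
      using rc_field_unimodular by blast
    have "((\<lambda>g. c * f (A g u) + d * f (B g v)) \<longlongrightarrow> c * ulim A f u + d * ulim B f v) U"
      by (intro tendsto_add tendsto_mult_left ulim_A ulim_B f u v)
    moreover have "c * f (A g u) + d * f (B g v) = f (A g (s c u) + B g (s d v))" for g
      using u v by (simp add: A_scale B_scale dualD[OF f] A_X B_X subspace_scale[OF X])
    ultimately have lim: "((\<lambda>g. norm (f (A g (s c u) + B g (s d v)))) \<longlongrightarrow>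
        norm (ulim A f u) + norm (ulim B f v)) U"
      using tendsto_norm by (fastforce simp: c d simp flip: of_real_add)
    have bound: "norm (ulim A f u) + norm (ulim B f v) \<le> dual_norm N X f * (1 + e)" if e: "e > 0" for e
    proof (rule tendsto_upperbound[OF lim _ U(1)], rule eventually_mono[OF AB_le[OF e]])
      fix g assume *: "\<forall>u\<in>X. \<forall>v\<in>X. N (A g u + B g v) \<le> (1 + e) * max (N u) (N v)"
      have sX: "s c u \<in> X" "s d v \<in> X" using u v subspace_scale[OF X] by auto
      have "N (A g (s c u) + B g (s d v)) \<le> (1 + e) * max (N (s c u)) (N (s d v))" using * sX by blast
      also have "\<dots> \<le> (1 + e) * 1" using u v c d e by (intro mult_left_mono) (auto simp: N_scale)
      finally show "norm (f (A g (s c u) + B g (s d v))) \<le> dual_norm N X f * (1 + e)"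
        using norm_le_dual_norm_times[OF f subspace_add[OF X A_X[OF sX(1)] B_X[OF sX(2)]], of g g]
          mult_left_mono[OF _ dual_norm_nonneg[OF f]] by (metis mult.right_neutral order_trans)
    qed
    \<comment> \<open>The bound holds for every e > 0, and e may tend to 0.\<close>
    have "((\<lambda>e. dual_norm N X f * (1 + e)) \<longlongrightarrow> dual_norm N X f * (1 + 0)) (at_right 0)"
      by (intro tendsto_intros)
    moreover have "\<forall>\<^sub>F e in at_right 0. norm (ulim A f u) + norm (ulim B f v) \<le> dual_norm N X f * (1 + e)"
      using bound by (auto simp: eventually_at_right_field intro!: exI[of _ 1])
    ultimately show ?thesis
      using tendsto_lowerbound[of _ _ "at_right (0::real)"] by fastforce
  qed
  \<comment> \<open>Two suprema one after the other: over \<open>u\<close> with \<open>v\<close>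
    fixed, then over \<open>v\<close>.\<close>
  have "dual_norm N X (ulim A f) \<le> dual_norm N X f - norm (ulim B f v)" if "v \<in> X" "N v \<le> 1" for v
    using le[OF _ _ that] by (intro dual_norm_least) (simp add: algebra_simps)
  then have "dual_norm N X (ulim B f) \<le> dual_norm N X f - dual_norm N X (ulim A f)"
    by (intro dual_norm_least) (simp add: algebra_simps)
  then show ?thesis by simp
qed

text \<open>
  The norm inequality forces \<open>ulim B\<close> to vanish on the range of the projection \<open>ulim A\<close>;
  on the annihilator of \<open>J\<close> it is the identity.
\<close>

lemma ulim_A_plus_ulim_B:
  assumes f: "f \<in> dual"
  shows "ulim A (ulim A f) = ulim A f" and "ulim B f = f - ulim A f"
proof -
  let ?g = "ulim A f"
  have g: "?g \<in> dual" using ulim_dual_A[OF f] .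
  have d: "f - ?g \<in> dual" using dual_minus[OF f g] .
  \<comment> \<open>Since f and \<pi> f agree on \<open>J\<close>, f is the sum of an element of the
    annihilator and \<pi> f.\<close>
  have dJ: "(f - ?g) u = 0" if "u \<in> J" for u using ulim_A_J[OF f that] by simp
  have "ulim A ((f - ?g) + ?g) = ulim A (f - ?g) + ulim A ?g"
    by (rule ulim_A_add[OF d g])
  then show gg: "ulim A ?g = ?g" using ulim_A_annihilator[OF d dJ] by simp
  have "dual_norm N X (ulim B ?g) \<le> 0" using ulim_norm_add_le[OF g] gg by simp
  then have "norm (ulim B ?g v) \<le> 0" if "v \<in> X" for v
    using norm_le_dual_norm_times[OF ulim_dual_B[OF g] that] N_nonneg[OF that]
    by (meson mult_nonpos_nonneg order_trans)
  then have B0: "ulim B ?g = 0"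
    by (intro ext) (auto simp: ulim_def)
  have "ulim B ((f - ?g) + ?g) = ulim B (f - ?g) + ulim B ?g"
    by (rule ulim_B_add[OF d g])
  then show "ulim B f = f - ?g"
    by (simp only: diff_add_cancel B0 add_0_right ulim_B_annihilator[OF d dJ])
qed

theorem M_idealI: "M_ideal s N X J"
proof -
  have norm_eq: "dual_norm N X f = dual_norm N X (ulim A f) + dual_norm N X (f - ulim A f)"
    if f: "f \<in> dual" for f
  proof (rule antisym)
    show "dual_norm N X f \<le> dual_norm N X (ulim A f) + dual_norm N X (f - ulim A f)"
      using dual_norm_triangle[OF ulim_dual_A[OF f] dual_minus[OF f ulim_dual_A[OF f]]] by simp
    show "dual_norm N X (ulim A f) + dual_norm N X (f - ulim A f) \<le> dual_norm N X f"
      using ulim_norm_add_le[OF f] ulim_A_plus_ulim_B(2)[OF f] by simp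
  qed
  have kernel: "{f \<in> dual. ulim A f = 0} = annihilator s N X J"
    unfolding annihilator_def
  proof (intro Collect_cong conj_cong refl iffI ballI)
    fix f v assume f: "f \<in> dual" and 0: "ulim A f = 0" and v: "v \<in> J"
    show "f v = 0" using ulim_A_J[OF f v] unfolding 0 by simp
  qed (use ulim_A_annihilator in blast)
  show ?thesis
    unfolding M_ideal_def
    using X J J_closed
    by (intro conjI exI[of _ "ulim A"])
      (auto simp: kernel ulim_dual_A ulim_A_add ulim_A_scale ulim_A_plus_ulim_B(1) intro: norm_eq)
qed

end

section \<open>Homogeneous polynomials\<close>

text \<open>Elimination in place of a Vandermonde determinant: for p of degree m + 1, the
  combination p(2t) - 2^(m+1) p(t) has degree at most m and multiplies the j-th coefficient by 2^j -
  2^(m+1), which is nonzero for j <= m. In this way properties of P(x + t y) pass to its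
  coefficients; \<open>V\<close> will be the continuous or the bounded functions.\<close>

lemma coefficient_in_subspace:
  fixes c :: "nat \<Rightarrow> 'z \<Rightarrow> 'f::real_vector"
  assumes V: "\<And>a b u v. u \<in> V \<Longrightarrow> v \<in> V \<Longrightarrow> (\<lambda>z. a *\<^sub>R u z + b *\<^sub>R v z) \<in> V"
    and p: "\<And>t::real. (\<lambda>z. \<Sum>j\<le>m. t ^ j *\<^sub>R c j z) \<in> V" and j: "j \<le> m"
  shows "c j \<in> V"
  using p j
proof (induction m arbitrary: c j)
  case 0
  then show ?case using "0.prems"(1)[of 1] by simp
next
  case (Suc m)
  define d where "d = (\<lambda>j z. (2 ^ j - 2 ^ Suc m) *\<^sub>R c j z)"
  have "(\<lambda>z. \<Sum>j\<le>m. t ^ j *\<^sub>R d j z) \<in> V" for t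
  proof -
    have "(\<lambda>z. 1 *\<^sub>R (\<Sum>j\<le>Suc m. (2 * t) ^ j *\<^sub>R c j z) + (- (2 ^ Suc m)) *\<^sub>R (\<Sum>j\<le>Suc m. t ^ j *\<^sub>R c j z)) \<in> V"
      by (intro V Suc.prems)
    also have "(\<lambda>z. 1 *\<^sub>R (\<Sum>j\<le>Suc m. (2 * t) ^ j *\<^sub>R c j z) + (- (2 ^ Suc m)) *\<^sub>R (\<Sum>j\<le>Suc m. t ^ j *\<^sub>R c j z))
        = (\<lambda>z. \<Sum>j\<le>Suc m. t ^ j *\<^sub>R d j z)"
      by (simp only: scaleR_sum_right sum.distrib[symmetric] d_def scaleR_scaleR scaleR_left_distrib[symmetric])
        (simp add: power_mult_distrib algebra_simps)
    also have "\<dots> = (\<lambda>z. \<Sum>j\<le>m. t ^ j *\<^sub>R d j z)" by (simp add: d_def)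
    finally show ?thesis .
  qed
  then have d: "d j \<in> V" if "j \<le> m" for j using Suc.IH that by blast
  have c: "c j \<in> V" if "j \<le> m" for j
  proof -
    have "(2::real) ^ j < 2 ^ Suc m" using that by (intro power_strict_increasing) auto
    then have "(\<lambda>z. (1 / (2 ^ j - 2 ^ Suc m)) *\<^sub>R d j z + 0 *\<^sub>R d j z) = c j"
      unfolding d_def by (intro ext) simp
    then show ?thesis using V[OF d[OF that] d[OF that]] by metis
  qed
  have s: "(\<lambda>z. \<Sum>j\<le>k. c j z) \<in> V" if "k \<le> m" for k
    using that
  proof (induction k)
    case 0
    then show ?case using c[of 0] by simp
  next
    case (Suc k)
    then show ?case using V[OF Suc.IH c[of "Suc k"], of 1 1] by simp
  qed
  \<comment> \<open>The top coefficient, eliminated above, is p(1) minus the sum of the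
    others.\<close>
  have "(\<lambda>z. 1 *\<^sub>R (\<Sum>j\<le>Suc m. 1 ^ j *\<^sub>R c j z) + (-1) *\<^sub>R (\<Sum>j\<le>m. c j z)) \<in> V"
    by (intro V Suc.prems s) simp
  then have "c (Suc m) \<in> V" by simp
  then show ?case using c Suc.prems(2) by (cases "j = Suc m") auto
qed

section \<open>Multilinear maps and expansion of polynomials\<close>

locale banach_pair = E: banach_over sE + F: banach_over sF
  for sE :: "'k::rc_field \<Rightarrow> 'e::banach \<Rightarrow> 'e" and sF :: "'k \<Rightarrow> 'f::banach \<Rightarrow> 'f"
begin

lemma linear_map_iff:
  "Vector_Spaces.linear sE sF T \<longleftrightarrow> (\<forall>x y. T (x + y) = T x + T y) \<and> (\<forall>c x. T (sE c x) = sF c (T x))"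
  unfolding Vector_Spaces.linear_iff using E.vector_space_axioms F.vector_space_axioms by blast

lemma multilinearD:
  assumes "multilinear n sE sF A"
  shows "(\<And>i. i < n \<Longrightarrow> v i = w i) \<Longrightarrow> A v = A w"
    and "i < n \<Longrightarrow> A (v(i := x + y)) = A (v(i := x)) + A (v(i := y))"
    and "i < n \<Longrightarrow> A (v(i := sE c x)) = sF c (A (v(i := x)))"
    and "i < n \<Longrightarrow> A (v(i := t *\<^sub>R x)) = t *\<^sub>R A (v(i := x))"
proof -
  show "(\<And>i. i < n \<Longrightarrow> v i = w i) \<Longrightarrow> A v = A w"
    using assms unfolding multilinear_def by blast
  assume i: "i < n"
  then show "A (v(i := x + y)) = A (v(i := x)) + A (v(i := y))"
    and "A (v(i := sE c x)) = sF c (A (v(i := x)))" for c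
    using assms unfolding multilinear_def linear_map_iff by blast+
  from this(2)[of "of_real t"] show "A (v(i := t *\<^sub>R x)) = t *\<^sub>R A (v(i := x))"
    by (simp add: E.scale_of_real F.scale_of_real)
qed

lemma multilinearI:
  assumes "\<And>v w. (\<And>i. i < n \<Longrightarrow> v i = w i) \<Longrightarrow> A v = A w"
    and "\<And>i v x y. i < n \<Longrightarrow> A (v(i := x + y)) = A (v(i := x)) + A (v(i := y))"
    and "\<And>i v c x. i < n \<Longrightarrow> A (v(i := sE c x)) = sF c (A (v(i := x)))"
  shows "multilinear n sE sF A"
  using assms unfolding multilinear_def linear_map_iff by blast

lemma poly_spaceE:
  assumes "P \<in> poly_space n sE sF"
  obtains A where "multilinear n sE sF A" "\<And>x. P x = A (\<lambda>_. x)" "continuous_on UNIV P"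
  using assms unfolding poly_space_def by blast

lemma poly_spaceI:
  assumes "multilinear n sE sF A" "\<And>x. P x = A (\<lambda>_. x)" "continuous_on UNIV P"
  shows "P \<in> poly_space n sE sF"
  using assms unfolding poly_space_def by blast

lemma multilinear_zero: "multilinear n sE sF (\<lambda>_. 0)"
  by (rule multilinearI) auto

lemma multilinear_add:
  assumes A: "multilinear n sE sF A" and B: "multilinear n sE sF B"
  shows "multilinear n sE sF (\<lambda>v. A v + B v)"
proof (rule multilinearI)
  show "A v + B v = A w + B w" if "\<And>i. i < n \<Longrightarrow> v i = w i" for v w
    using multilinearD(1)[OF A that] multilinearD(1)[OF B that] by simp
qed (simp_all add: multilinearD(2,3)[OF A] multilinearD(2,3)[OF B] F.scale_right_distrib)

lemma multilinear_scale:
  assumes A: "multilinear n sE sF A"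
  shows "multilinear n sE sF (\<lambda>v. sF c (A v))"
proof (rule multilinearI)
  show "sF c (A v) = sF c (A w)" if "\<And>i. i < n \<Longrightarrow> v i = w i" for v w
    using multilinearD(1)[OF A that] by simp
qed (simp_all add: multilinearD(2,3)[OF A] F.scale_right_distrib F.scale_left_commute)

lemma multilinear_sum:
  assumes "finite I" "\<And>i. i \<in> I \<Longrightarrow> multilinear n sE sF (A i)"
  shows "multilinear n sE sF (\<lambda>v. \<Sum>i\<in>I. A i v)"
  using assms by (induction I rule: finite_induct) (auto intro: multilinear_zero multilinear_add)

text \<open>One slot is expanded at a time, the slots from \<open>k\<close> on being held by
  \<open>v\<close>; subsets of the first k + 1 slots split according to whether they contain
  \<open>k\<close>.\<close>

lemma multilinear_diagonal_add:
  assumes A: "multilinear m sE sF A" and k: "k \<le> m"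
  shows "A (\<lambda>i. if i < k then x + y else v i) =
    (\<Sum>S\<in>Pow {..<k}. A (\<lambda>i. if i < k then (if i \<in> S then y else x) else v i))"
  using k
proof (induction k arbitrary: v)
  case 0
  then show ?case by simp
next
  case (Suc k)
  define g where "g = (\<lambda>S i. if i < k then (if i \<in> S then y else x) else v i)"
  have "A (\<lambda>i. if i < Suc k then x + y else v i) = A (\<lambda>i. if i < k then x + y else (v(k := x + y)) i)"
    by (rule arg_cong[where f = A]) (auto simp: less_Suc_eq)
  also have "\<dots> = (\<Sum>S\<in>Pow {..<k}. A (\<lambda>i. if i < k then (if i \<in> S then y else x) else (v(k := x + y)) i))"
    using Suc by simp
  also have "\<dots> = (\<Sum>S\<in>Pow {..<k}. A ((g S)(k := x + y)))"
    by (intro sum.cong refl arg_cong[where f = A]) (auto simp: g_def)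
  also have "\<dots> = (\<Sum>S\<in>Pow {..<k}. A ((g S)(k := x))) + (\<Sum>S\<in>Pow {..<k}. A ((g S)(k := y)))"
    using Suc.prems by (simp add: multilinearD(2)[OF A] sum.distrib)
  also have "(\<Sum>S\<in>Pow {..<k}. A ((g S)(k := x))) =
      (\<Sum>S\<in>Pow {..<k}. A (\<lambda>i. if i < Suc k then (if i \<in> S then y else x) else v i))"
    by (intro sum.cong refl arg_cong[where f = A]) (auto simp: g_def less_Suc_eq fun_eq_iff)
  also have "(\<Sum>S\<in>Pow {..<k}. A ((g S)(k := y))) =
      (\<Sum>S\<in>insert k ` Pow {..<k}. A (\<lambda>i. if i < Suc k then (if i \<in> S then y else x) else v i))"
  proof (subst sum.reindex)
    show "inj_on (insert k) (Pow {..<k})"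
      by (rule inj_onI) (metis Diff_insert_absorb Pow_iff lessThan_iff less_irrefl subsetD)
  qed (auto intro!: sum.cong arg_cong[where f = A] simp: g_def less_Suc_eq)
  also have "(\<Sum>S\<in>Pow {..<k}. A (\<lambda>i. if i < Suc k then (if i \<in> S then y else x) else v i)) +
      (\<Sum>S\<in>insert k ` Pow {..<k}. A (\<lambda>i. if i < Suc k then (if i \<in> S then y else x) else v i)) =
      (\<Sum>S\<in>Pow {..<Suc k}. A (\<lambda>i. if i < Suc k then (if i \<in> S then y else x) else v i))"
    unfolding lessThan_Suc Pow_insert by (rule sum.union_disjoint[symmetric]) auto
  finally show ?case .
qed

lemma multilinear_scale_on:
  assumes A: "multilinear m sE sF A" and S: "finite S" "S \<subseteq> {..<m}"
  shows "A (\<lambda>i. if i \<in> S then t *\<^sub>R y else v i) = t ^ card S *\<^sub>R A (\<lambda>i. if i \<in> S then y else v i)"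
  using S
proof (induction S arbitrary: v rule: finite_induct)
  case empty
  then show ?case by simp
next
  case (insert a S)
  have "A (\<lambda>i. if i \<in> insert a S then t *\<^sub>R y else v i) = A (\<lambda>i. if i \<in> S then t *\<^sub>R y else (v(a := t *\<^sub>R y)) i)"
    by (rule arg_cong[where f = A]) auto
  also have "\<dots> = t ^ card S *\<^sub>R A (\<lambda>i. if i \<in> S then y else (v(a := t *\<^sub>R y)) i)"
    using insert by simp
  also have "(\<lambda>i. if i \<in> S then y else (v(a := t *\<^sub>R y)) i) = (\<lambda>i. if i \<in> S then y else v i)(a := t *\<^sub>R y)"
    using insert.hyps by auto
  also have "A \<dots> = t *\<^sub>R A ((\<lambda>i. if i \<in> S then y else v i)(a := y))"
    using insert.prems by (simp add: multilinearD(4)[OF A])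
  also have "(\<lambda>i. if i \<in> S then y else v i)(a := y) = (\<lambda>i. if i \<in> insert a S then y else v i)"
    by auto
  finally show ?case using insert.hyps by simp
qed

text \<open>Freezing the slots in \<open>S\<close> leaves scattered free slots, while
  \<open>multilinear\<close> counts its arguments from 0; the bijection \<open>e\<close> renumbers
  the free ones.\<close>

lemma multilinear_fix_on:
  assumes A: "multilinear m sE sF A" and S: "S \<subseteq> {..<m}"
  obtains B where "multilinear (m - card S) sE sF B" "\<And>x. A (\<lambda>i. if i \<in> S then y else x) = B (\<lambda>_. x)"
proof -
  have fin: "finite S" using S finite_subset by blast
  have "card ({..<m} - S) = m - card S" using S fin by (simp add: card_Diff_subset)
  then obtain e where e: "bij_betw e ({..<m} - S) {..<m - card S}"
    using finite_same_card_bij[of "{..<m} - S" "{..<m - card S}"] by auto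
  define B where "B = (\<lambda>w. A (\<lambda>i. if i \<in> S then y else w (e i)))"
  \<comment> \<open>Changing argument \<open>k\<close> of \<open>B\<close> changes exactly one slot
    of \<open>A\<close>, the one that \<open>e\<close> sends to \<open>k\<close>.\<close>
  have upd: "\<exists>j<m. \<forall>w x. B (w(k := x)) = A ((\<lambda>i. if i \<in> S then y else w (e i))(j := x))"
    if k: "k < m - card S" for k
  proof -
    obtain j where j: "j \<in> {..<m} - S" "e j = k"
      using e k unfolding bij_betw_def by (metis imageE lessThan_iff)
    have "B (w(k := x)) = A ((\<lambda>i. if i \<in> S then y else w (e i))(j := x))" for w x
      unfolding B_def
    proof (rule multilinearD(1)[OF A])
      fix i assume "i < m"
      then show "(if i \<in> S then y else (w(k := x)) (e i)) = ((\<lambda>i. if i \<in> S then y else w (e i))(j := x)) i"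
        using j bij_betw_imp_inj_on[OF e] by (auto simp: inj_on_def)
    qed
    then show ?thesis using j by blast
  qed
  have "multilinear (m - card S) sE sF B"
  proof (rule multilinearI)
    fix v w :: "nat \<Rightarrow> 'e" assume vw: "\<And>i. i < m - card S \<Longrightarrow> v i = w i"
    show "B v = B w"
      unfolding B_def
    proof (rule multilinearD(1)[OF A])
      fix i assume "i < m"
      then show "(if i \<in> S then y else v (e i)) = (if i \<in> S then y else w (e i))"
        using vw bij_betw_apply[OF e, of i] by auto
    qed
  next
    fix k v x z assume "k < m - card S"
    then obtain j where j: "j < m" "\<And>w x. B (w(k := x)) = A ((\<lambda>i. if i \<in> S then y else w (e i))(j := x))"
      using upd by blast
    show "B (v(k := x + z)) = B (v(k := x)) + B (v(k := z))"
      unfolding j(2) by (rule multilinearD(2)[OF A j(1)])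
  next
    fix k v c x assume "k < m - card S"
    then obtain j where j: "j < m" "\<And>w x. B (w(k := x)) = A ((\<lambda>i. if i \<in> S then y else w (e i))(j := x))"
      using upd by blast
    show "B (v(k := sE c x)) = sF c (B (v(k := x)))"
      unfolding j(2) by (rule multilinearD(3)[OF A j(1)])
  qed
  then show thesis using that[of B] by (simp add: B_def)
qed

text \<open>The multilinear map need not be symmetric, so the coefficient of t^j sums over all
  choices of j slots for \<open>y\<close> instead of being a binomial multiple of one value.\<close>

lemma poly_space_expand:
  assumes P: "P \<in> poly_space m sE sF"
  obtains c where "\<And>x y t. P (x + t *\<^sub>R y) = (\<Sum>j\<le>m. t ^ j *\<^sub>R c j y x)"
    and "\<And>j y. j \<le> m \<Longrightarrow> c j y \<in> poly_space (m - j) sE sF"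
proof -
  obtain A where A: "multilinear m sE sF A" "\<And>x. P x = A (\<lambda>_. x)" "continuous_on UNIV P"
    using poly_spaceE[OF P] by metis
  define c where "c = (\<lambda>j y x. \<Sum>S\<in>{S \<in> Pow {..<m}. card S = j}. A (\<lambda>i. if i \<in> S then y else x))"
  have expand: "P (x + t *\<^sub>R y) = (\<Sum>j\<le>m. t ^ j *\<^sub>R c j y x)" for x y t
  proof -
    have "P (x + t *\<^sub>R y) = A (\<lambda>i. if i < m then x + t *\<^sub>R y else x)"
      unfolding A(2) by (rule multilinearD(1)[OF A(1)]) simp
    also have "\<dots> = (\<Sum>S\<in>Pow {..<m}. A (\<lambda>i. if i < m then (if i \<in> S then t *\<^sub>R y else x) else x))"
      by (rule multilinear_diagonal_add[OF A(1) order_refl])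
    also have "\<dots> = (\<Sum>S\<in>Pow {..<m}. A (\<lambda>i. if i \<in> S then t *\<^sub>R y else x))"
      by (intro sum.cong refl multilinearD(1)[OF A(1)]) auto
    also have "\<dots> = (\<Sum>S\<in>Pow {..<m}. t ^ card S *\<^sub>R A (\<lambda>i. if i \<in> S then y else x))"
      by (intro sum.cong refl multilinear_scale_on[OF A(1)]) (auto intro: finite_subset)
    also have "\<dots> = (\<Sum>j\<in>{..m}. \<Sum>S\<in>{S \<in> Pow {..<m}. card S = j}. t ^ card S *\<^sub>R A (\<lambda>i. if i \<in> S then y else x))"
      using card_mono[of "{..<m}"] by (intro sum.group[symmetric]) auto
    also have "\<dots> = (\<Sum>j\<le>m. t ^ j *\<^sub>R c j y x)"
      by (simp add: c_def scaleR_sum_right)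
    finally show ?thesis .
  qed
  moreover have "c j y \<in> poly_space (m - j) sE sF" if j: "j \<le> m" for j y
  proof -
    have "\<exists>B. multilinear (m - j) sE sF B \<and> (\<forall>x. A (\<lambda>i. if i \<in> S then y else x) = B (\<lambda>_. x))"
      if "S \<in> {S \<in> Pow {..<m}. card S = j}" for S
    proof -
      have S: "S \<subseteq> {..<m}" "card S = j" using that by auto
      obtain B where "multilinear (m - card S) sE sF B" "\<And>x. A (\<lambda>i. if i \<in> S then y else x) = B (\<lambda>_. x)"
        using multilinear_fix_on[OF A(1) S(1), of y] by blast
      then show ?thesis using S(2) by blast
    qed
    then have "\<forall>S\<in>{S \<in> Pow {..<m}. card S = j}. \<exists>B. multilinear (m - j) sE sF B \<and>
        (\<forall>x. A (\<lambda>i. if i \<in> S then y else x) = B (\<lambda>_. x))" by (rule ballI)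
    from bchoice[OF this] obtain B where B: "\<And>S. S \<in> {S \<in> Pow {..<m}. card S = j} \<Longrightarrow> multilinear (m - j) sE sF (B S)"
      "\<And>S x. S \<in> {S \<in> Pow {..<m}. card S = j} \<Longrightarrow> A (\<lambda>i. if i \<in> S then y else x) = B S (\<lambda>_. x)"
      by blast
    \<comment> \<open>Continuity is given for \<open>P\<close>, not for \<open>A\<close>; that of
      the coefficients is read off from the functions x -> P(x + t y), for all t.\<close>
    have "(\<lambda>x. c j y x) \<in> {f. continuous_on UNIV f}"
    proof (rule coefficient_in_subspace[where m = m and c = "\<lambda>j x. c j y x"])
      fix t :: real
      have "continuous_on UNIV (\<lambda>x. P (x + t *\<^sub>R y))"
        by (rule continuous_on_compose2[OF A(3)]) (auto intro!: continuous_intros)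
      then show "(\<lambda>x. \<Sum>j\<le>m. t ^ j *\<^sub>R c j y x) \<in> {f. continuous_on UNIV f}"
        unfolding expand by simp
    qed (auto intro!: continuous_intros j)
    then show ?thesis
      by (intro poly_spaceI[of _ "\<lambda>v. \<Sum>S\<in>{S \<in> Pow {..<m}. card S = j}. B S v"] multilinear_sum B)
        (simp_all add: c_def B(2))
  qed
  ultimately show thesis by (rule that)
qed

lemma poly_space_scaleR:
  assumes "P \<in> poly_space m sE sF"
  shows "P (t *\<^sub>R x) = t ^ m *\<^sub>R P x"
proof -
  obtain A where A: "multilinear m sE sF A" "\<And>x. P x = A (\<lambda>_. x)"
    using poly_spaceE[OF assms] by metis
  have "P (t *\<^sub>R x) = A (\<lambda>i. if i \<in> {..<m} then t *\<^sub>R x else 0)"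
    unfolding A(2) by (rule multilinearD(1)[OF A(1)]) simp
  also have "\<dots> = t ^ m *\<^sub>R A (\<lambda>i. if i \<in> {..<m} then x else 0)"
    using multilinear_scale_on[OF A(1), of "{..<m}" t x "\<lambda>_. 0"] by simp
  also have "A (\<lambda>i. if i \<in> {..<m} then x else 0) = P x"
    unfolding A(2) by (rule multilinearD(1)[OF A(1)]) simp
  finally show ?thesis .
qed

lemma poly_space_zero_at_0: "P \<in> poly_space m sE sF \<Longrightarrow> m \<ge> 1 \<Longrightarrow> P 0 = 0"
  using poly_space_scaleR[of P m 0 0] by (simp add: power_0_left)

lemma poly_space_degree_0: "P \<in> poly_space 0 sE sF \<Longrightarrow> P x = P 0"
  using poly_space_scaleR[of P 0 0 x] by simp

section \<open>Growth and Lipschitz estimates for polynomials\<close>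

lemma poly_space_bounded:
  assumes P: "P \<in> poly_space m sE sF"
  obtains C where "C \<ge> 0" "\<And>x. norm (P x) \<le> C * norm x ^ m"
proof -
  have "continuous_on UNIV P" using poly_spaceE[OF P] by metis
  then obtain d where d: "d > 0" "\<And>x. dist x 0 < d \<Longrightarrow> dist (P x) (P 0) < 1"
    unfolding continuous_on_iff by (metis UNIV_I zero_less_one)
  \<comment> \<open>At norm d / 2 the values of \<open>P\<close> are bounded by norm (P 0) + 1;
    homogeneity transports this to x by the factor (2 norm x / d)^m.\<close>
  define C where "C = (norm (P 0) + 1) * (2 / d) ^ m"
  have C: "C \<ge> 0" using d by (simp add: C_def)
  have "norm (P x) \<le> C * norm x ^ m" for x
  proof (cases "x = 0")
    case True
    \<comment> \<open>In degree 0 the right-hand side is \<open>C\<close>, because 0 ^ 0 = 1; in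
      positive degree both sides vanish.\<close>
    show ?thesis
    proof (cases "m = 0")
      case True
      then show ?thesis using d poly_space_degree_0[of P x] P by (simp add: C_def)
    next
      case False
      then show ?thesis using poly_space_zero_at_0[OF P] \<open>x = 0\<close> C by simp
    qed
  next
    case False
    define w where "w = (d / (2 * norm x)) *\<^sub>R x"
    have "norm w < d" using False d by (simp add: w_def)
    then have "norm (P w - P 0) < 1" using d(2)[of w] by (simp add: dist_norm)
    then have "norm (P w) \<le> norm (P 0) + 1" using norm_triangle_ineq2[of "P w" "P 0"] by linarith
    moreover have "x = (2 * norm x / d) *\<^sub>R w" using False d by (simp add: w_def)
    then have "norm (P x) = (2 * norm x / d) ^ m * norm (P w)"
      using poly_space_scaleR[OF P, of "2 * norm x / d" w] d by simp
    ultimately have "norm (P x) \<le> (2 * norm x / d) ^ m * (norm (P 0) + 1)"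
      using d by (simp add: mult_left_mono)
    then show ?thesis by (simp add: C_def power_mult_distrib power_divide mult_ac)
  qed
  then show thesis using that C by blast
qed

lemma poly_norm_bdd:
  assumes P: "P \<in> poly_space m sE sF"
  shows "bdd_above ((\<lambda>x. norm (P x)) ` cball 0 1)"
proof -
  obtain C where C: "C \<ge> 0" "\<And>x. norm (P x) \<le> C * norm x ^ m"
    using poly_space_bounded[OF P] by blast
  have "norm (P x) \<le> C" if "norm x \<le> 1" for x
    using C(2)[of x] mult_left_mono[OF power_le_one[of "norm x" m] C(1)] that by simp
  then show ?thesis by (intro bdd_aboveI2[where M = C]) simp
qed

lemma poly_norm_nonneg:
  assumes P: "P \<in> poly_space m sE sF"
  shows "0 \<le> poly_norm P"
  unfolding poly_norm_def
  by (rule cSUP_upper2[OF poly_norm_bdd[OF P], of 0]) auto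

lemma norm_le_poly_norm:
  assumes P: "P \<in> poly_space m sE sF"
  shows "norm (P x) \<le> poly_norm P * norm x ^ m"
proof (cases "x = 0")
  case True
  have "norm (P 0) \<le> poly_norm P"
    unfolding poly_norm_def by (rule cSUP_upper[OF _ poly_norm_bdd[OF P]]) simp
  then show ?thesis
    using True poly_space_zero_at_0[OF P] by (cases "m = 0") auto
next
  case False
  have "norm (P (x /\<^sub>R norm x)) \<le> poly_norm P"
    unfolding poly_norm_def by (rule cSUP_upper[OF _ poly_norm_bdd[OF P]]) (simp add: False)
  moreover have "norm (P x) = norm x ^ m * norm (P (x /\<^sub>R norm x))"
    using poly_space_scaleR[OF P, of "norm x" "x /\<^sub>R norm x"] False by simp
  ultimately show ?thesis by (simp add: mult_left_mono mult.commute[of "poly_norm P"])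
qed

lemma poly_norm_least: "(\<And>x. norm x \<le> 1 \<Longrightarrow> norm (P x) \<le> C) \<Longrightarrow> poly_norm P \<le> C"
  unfolding poly_norm_def by (intro cSUP_least) auto

text \<open>A Taylor estimate: along the unit direction of x - y the increment is a sum of terms t^j
  times coefficients with j >= 1, and t^j <= t because t <= 1. The coefficients are bounded
  uniformly in base point and direction by \<open>coefficient_in_subspace\<close>, since P(x + t y)
  is so for each t.\<close>

lemma poly_space_lipschitz:
  assumes P: "P \<in> poly_space m sE sF"
  obtains M where "M \<ge> 0"
    "\<And>x y. norm x \<le> r \<Longrightarrow> norm y \<le> r \<Longrightarrow> norm (x - y) \<le> 1 \<Longrightarrow> norm (P x - P y) \<le> M * norm (x - y)"
proof -
  obtain C where C: "C \<ge> 0" "\<And>x. norm (P x) \<le> C * norm x ^ m"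
    using poly_space_bounded[OF P] by blast
  obtain c where c: "\<And>x y t. P (x + t *\<^sub>R y) = (\<Sum>j\<le>m. t ^ j *\<^sub>R c j y x)"
    using poly_space_expand[OF P] by metis
  define Z :: "('e \<times> 'e) set" where "Z = cball 0 r \<times> cball 0 1"
  have "(\<lambda>z. c j (snd z) (fst z)) \<in> {f. bounded (f ` Z)}" if "j \<le> m" for j
  proof (rule coefficient_in_subspace[where m = m and c = "\<lambda>j z. c j (snd z) (fst z)", OF _ _ that])
    fix a b :: real and u v :: "'e \<times> 'e \<Rightarrow> 'f"
    assume "u \<in> {f. bounded (f ` Z)}" "v \<in> {f. bounded (f ` Z)}"
    then obtain B D where BD: "\<And>z. z \<in> Z \<Longrightarrow> norm (u z) \<le> B" "\<And>z. z \<in> Z \<Longrightarrow> norm (v z) \<le> D"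
      by (auto simp: bounded_iff)
    have "norm (a *\<^sub>R u z + b *\<^sub>R v z) \<le> \<bar>a\<bar> * B + \<bar>b\<bar> * D" if "z \<in> Z" for z
      by (rule order_trans[OF norm_triangle_ineq]) (auto intro!: add_mono mult_left_mono BD that)
    then show "(\<lambda>z. a *\<^sub>R u z + b *\<^sub>R v z) \<in> {f. bounded (f ` Z)}"
      unfolding mem_Collect_eq bounded_iff ball_simps by blast
  next
    fix t :: real
    have "norm (P (fst z + t *\<^sub>R snd z)) \<le> C * (r + \<bar>t\<bar>) ^ m" if "z \<in> Z" for z
    proof -
      have "norm (fst z + t *\<^sub>R snd z) \<le> norm (fst z) + \<bar>t\<bar> * norm (snd z)"
        by (rule order_trans[OF norm_triangle_ineq]) simp
      also have "\<dots> \<le> r + \<bar>t\<bar> * 1"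
        using that by (intro add_mono mult_left_mono) (auto simp: Z_def)
      finally have "C * norm (fst z + t *\<^sub>R snd z) ^ m \<le> C * (r + \<bar>t\<bar>) ^ m"
        by (intro mult_left_mono power_mono C(1)) auto
      then show ?thesis using C(2) order_trans by blast
    qed
    then have "(\<lambda>z. P (fst z + t *\<^sub>R snd z)) \<in> {f. bounded (f ` Z)}"
      unfolding mem_Collect_eq bounded_iff ball_simps by blast
    then show "(\<lambda>z. \<Sum>j\<le>m. t ^ j *\<^sub>R c j (snd z) (fst z)) \<in> {f. bounded (f ` Z)}"
      unfolding c .
  qed
  then have "\<forall>j\<in>{..m}. \<exists>B. \<forall>z\<in>Z. norm (c j (snd z) (fst z)) \<le> B"
    by (auto simp: bounded_iff)
  then obtain B where B: "\<And>j z. j \<le> m \<Longrightarrow> z \<in> Z \<Longrightarrow> norm (c j (snd z) (fst z)) \<le> B j"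
    by (metis atMost_iff)
  define M where "M = (\<Sum>j=1..m. \<bar>B j\<bar>)"
  have "norm (P x - P y) \<le> M * norm (x - y)"
    if xy: "norm x \<le> r" "norm y \<le> r" "norm (x - y) \<le> 1" for x y
  proof (cases "x = y")
    case False
    define t where "t = norm (x - y)"
    define w where "w = (x - y) /\<^sub>R t"
    have t: "0 < t" "t \<le> 1" using False xy by (auto simp: t_def)
    have w: "norm w \<le> 1" "x = y + t *\<^sub>R w" using t False by (simp_all add: w_def t_def)
    have z: "(y, w) \<in> Z" using xy w by (simp add: Z_def)
    have split: "(\<Sum>j\<le>m. g j) = g 0 + (\<Sum>j=1..m. g j)" for g :: "nat \<Rightarrow> 'f"
      by (simp add: atMost_atLeast0 sum.atLeast_Suc_atMost)
    have "P y = c 0 w y" using c[of y 0 w] by (simp add: split power_0_left)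
    then have "P x - P y = (\<Sum>j=1..m. t ^ j *\<^sub>R c j w y)"
      unfolding w(2) using c[of y t w] by (simp add: split)
    also have "norm \<dots> \<le> (\<Sum>j=1..m. t * \<bar>B j\<bar>)"
    proof (rule sum_norm_le)
      fix j assume j: "j \<in> {1..m}"
      have "t ^ j \<le> t ^ 1" using j t by (intro power_decreasing) auto
      moreover have "norm (c j w y) \<le> \<bar>B j\<bar>" using B[OF _ z] j by fastforce
      ultimately show "norm (t ^ j *\<^sub>R c j w y) \<le> t * \<bar>B j\<bar>"
        using t by (simp add: mult_mono)
    qed
    finally show ?thesis by (simp add: M_def sum_distrib_left mult.commute flip: t_def)
  qed simp
  moreover have "M \<ge> 0" by (simp add: M_def sum_nonneg)
  ultimately show thesis using that by blast
qed

lemma poly_space_diff_tendsto: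
  assumes P: "P \<in> poly_space m sE sF"
    and bounded: "\<forall>\<^sub>F i in G. norm (\<xi> i) \<le> r" "\<forall>\<^sub>F i in G. norm (\<eta> i) \<le> r"
    and lim: "((\<lambda>i. \<xi> i - \<eta> i) \<longlongrightarrow> 0) G"
  shows "((\<lambda>i. P (\<xi> i) - P (\<eta> i)) \<longlongrightarrow> 0) G"
proof -
  obtain M where M: "M \<ge> 0"
    "\<And>x y. norm x \<le> r \<Longrightarrow> norm y \<le> r \<Longrightarrow> norm (x - y) \<le> 1 \<Longrightarrow> norm (P x - P y) \<le> M * norm (x - y)"
    using poly_space_lipschitz[OF P] by blast
  have "\<forall>\<^sub>F i in G. dist (\<xi> i - \<eta> i) 0 < 1" using lim by (rule tendstoD) simp
  with bounded have "\<forall>\<^sub>F i in G. norm (P (\<xi> i) - P (\<eta> i)) \<le> M * norm (\<xi> i - \<eta> i)"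
    by eventually_elim (auto intro: M)
  moreover have "((\<lambda>i. M * norm (\<xi> i - \<eta> i)) \<longlongrightarrow> 0) G"
    using tendsto_mult_left[OF tendsto_norm_zero[OF lim], of M] by simp
  ultimately show ?thesis by (rule Lim_null_comparison)
qed

text \<open>The degree drop behind both uses of n = cd(E, F): the terms of top degree cancel, and
  the coefficient of order j >= 1 in the expansion at t = -1 has degree k = m - j.\<close>

lemma poly_space_translate:
  assumes P: "P \<in> poly_space m sE sF"
  obtains c where "\<And>x. P x - P (x - y) = (\<Sum>k<m. c k x)" "\<And>k. k < m \<Longrightarrow> c k \<in> poly_space k sE sF"
proof -
  obtain c where c: "\<And>x y t. P (x + t *\<^sub>R y) = (\<Sum>j\<le>m. t ^ j *\<^sub>R c j y x)"
    and cP: "\<And>j y. j \<le> m \<Longrightarrow> c j y \<in> poly_space (m - j) sE sF"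
    by (rule poly_space_expand[OF P]) (rule that)
  define d where "d = (\<lambda>k. poly_scale sF (of_real (- ((-1) ^ (m - k)))) (c (m - k) y))"
  have split: "(\<Sum>j\<le>m. g j) = g 0 + (\<Sum>j=1..m. g j)" for g :: "nat \<Rightarrow> 'f"
    by (simp add: atMost_atLeast0 sum.atLeast_Suc_atMost)
  have "P x - P (x - y) = (\<Sum>k<m. d k x)" for x
  proof -
    have "P x = c 0 y x" using c[of x 0 y] by (simp add: split power_0_left)
    then have "P x - P (x - y) = - (\<Sum>j=1..m. (-1) ^ j *\<^sub>R c j y x)"
      using c[of x "-1" y] by (simp add: split)
    also have "\<dots> = (\<Sum>j=1..m. (- ((-1) ^ j)) *\<^sub>R c j y x)" by (simp add: sum_negf)
    also have "\<dots> = (\<Sum>k<m. (- ((-1) ^ (m - k))) *\<^sub>R c (m - k) y x)"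
      by (rule sum.reindex_bij_witness[of _ "\<lambda>k. m - k" "\<lambda>j. m - j"]) auto
    finally show ?thesis by (simp only: d_def poly_scale_def F.scale_of_real)
  qed
  moreover have "d k \<in> poly_space k sE sF" if "k < m" for k
  proof -
    have "c (m - k) y \<in> poly_space k sE sF" using cP[of "m - k" y] that by simp
    then obtain A where A: "multilinear k sE sF A" "\<And>x. c (m - k) y x = A (\<lambda>_. x)" 
        "continuous_on UNIV (c (m - k) y)"
      using poly_spaceE by metis
    have d: "d k = (\<lambda>x. (- ((-1) ^ (m - k))) *\<^sub>R c (m - k) y x)"
      by (rule ext) (simp only: d_def poly_scale_def F.scale_of_real)
    show ?thesis
    proof (rule poly_spaceI[OF multilinear_scale[OF A(1), of "of_real (- ((-1) ^ (m - k)))"]])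
      show "d k x = sF (of_real (- ((-1) ^ (m - k)))) (A (\<lambda>_. x))" for x
        by (simp only: d F.scale_of_real A(2))
      show "continuous_on UNIV (d k)" unfolding d by (intro continuous_intros A(3))
    qed
  qed
  ultimately show thesis using that by blast
qed

end

section \<open>Weak continuity on bounded sets\<close>

context banach_over
begin

lemma linear_scaleR: "Vector_Spaces.linear s s T \<Longrightarrow> T (r *\<^sub>R x) = r *\<^sub>R T x"
  unfolding Vector_Spaces.linear_iff by (metis scale_of_real)

lemma compact_operator_bounded_linear:
  assumes T: "compact_operator s T"
  shows "bounded_linear T"
proof -
  have lin: "Vector_Spaces.linear s s T" and "compact (closure (T ` cball 0 1))"
    using T unfolding compact_operator_def by blast+
  then have "bounded (T ` cball 0 1)" using compact_imp_bounded bounded_subset closure_subset by blast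
  then obtain B where "\<forall>x\<in>cball 0 1. norm (T x) \<le> B"
    unfolding bounded_iff by auto
  then have B: "norm (T x) \<le> B" if "norm x \<le> 1" for x using that by simp
  show ?thesis
  proof (rule bounded_linear_intro[where K = B])
    fix x
    show "norm (T x) \<le> norm x * B"
    proof (cases "x = 0")
      case True
      then show ?thesis using linear_scaleR[OF lin, of 0 0] by simp
    next
      case False
      have "norm (T (x /\<^sub>R norm x)) \<le> B" by (rule B) (simp add: False)
      then show ?thesis using False by (simp add: linear_scaleR[OF lin] field_simps)
    qed
  qed (use lin linear_scaleR[OF lin] in \<open>auto simp: Vector_Spaces.linear_iff\<close>)
qed

lemma dual_bounded_linear:
  assumes "\<phi> \<in> dual_space s norm UNIV"
  shows "bounded_linear \<phi>"
proof -
  obtain C where C: "\<And>x. norm (\<phi> x) \<le> C * norm x" using assms unfolding dual_space_def by blast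
  show ?thesis
  proof (rule bounded_linear_intro[where K = C])
    show "\<phi> (r *\<^sub>R x) = r *\<^sub>R \<phi> x" for r x
    proof -
      have "\<phi> (s (of_real r) x) = of_real r * \<phi> x"
        using assms unfolding dual_space_def by blast
      then show ?thesis by (simp add: scale_of_real scaleR_conv_of_real)
    qed
  qed (use assms C in \<open>auto simp: dual_space_def mult.commute\<close>)
qed

lemma dual_comp:
  assumes \<phi>: "\<phi> \<in> dual_space s norm UNIV" and lin: "Vector_Spaces.linear s s T" and T: "bounded_linear T"
  shows "(\<lambda>x. \<phi> (T x)) \<in> dual_space s norm UNIV"
proof -
  have "bounded_linear (\<lambda>x. \<phi> (T x))"
    using bounded_linear_compose[OF dual_bounded_linear[OF \<phi>] T] .
  then obtain C where "\<And>x. norm (\<phi> (T x)) \<le> norm x * C" using bounded_linear.bounded by blast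
  then have "\<forall>x\<in>UNIV. norm (\<phi> (T x)) \<le> C * norm x" by (simp add: mult.commute)
  then show ?thesis
    using \<phi> lin unfolding dual_space_def Vector_Spaces.linear_iff by auto
qed

lemma seminormed_carrier_UNIV: "seminormed_carrier s norm UNIV"
  by unfold_locales (auto simp: norm_scale)

text \<open>If the values did not converge, those outside a neighbourhood of T x would cluster, by
  compactness, at some z different from T x; a functional separating z from T x then contradicts
  weak convergence.\<close>

lemma compact_operator_tendsto:
  assumes T: "compact_operator s T" and bdd: "\<forall>\<^sub>F i in G. norm (\<xi> i) \<le> r"
    and weak: "\<And>\<phi>. \<phi> \<in> dual_space s norm UNIV \<Longrightarrow> ((\<lambda>i. \<phi> (\<xi> i)) \<longlongrightarrow> \<phi> x) G"
  shows "((\<lambda>i. T (\<xi> i)) \<longlongrightarrow> T x) G"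
proof (rule topological_tendstoI, rule ccontr)
  fix S assume S: "open S" "T x \<in> S" and not: "\<not> (\<forall>\<^sub>F i in G. T (\<xi> i) \<in> S)"
  define G' where "G' = inf G (principal {i. T (\<xi> i) \<notin> S})"
  have G': "G' \<noteq> bot" "G' \<le> G"
    using not by (auto simp: G'_def trivial_limit_def eventually_inf_principal)
  \<comment> \<open>The maximum with 1 makes the scaling factor positive for every
    \<open>r\<close>.\<close>
  define R where "R = max r 1"
  have lin: "Vector_Spaces.linear s s T" using T unfolding compact_operator_def by blast
  define C where "C = (\<lambda>y. R *\<^sub>R y) ` closure (T ` cball 0 1)"
  have C: "compact C"
    unfolding C_def using T unfolding compact_operator_def by (blast intro: compact_scaling)
  have mem: "T z \<in> C" if "norm z \<le> r" for z
  proof -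
    have R: "R > 0" "norm z \<le> R" using that by (auto simp: R_def)
    then have "z /\<^sub>R R \<in> cball 0 1" by (simp add: field_simps)
    then have "T (z /\<^sub>R R) \<in> closure (T ` cball 0 1)" by (rule subsetD[OF closure_subset imageI])
    moreover have "T z = R *\<^sub>R T (z /\<^sub>R R)" using R by (simp add: linear_scaleR[OF lin])
    ultimately show ?thesis unfolding C_def by blast
  qed
  have "\<forall>\<^sub>F i in G'. norm (\<xi> i) \<le> r" using bdd filter_leD[OF G'(2)] by blast
  then have "\<forall>\<^sub>F y in filtermap (\<lambda>i. T (\<xi> i)) G'. y \<in> C"
    unfolding eventually_filtermap by (rule eventually_mono) (rule mem)
  moreover have "filtermap (\<lambda>i. T (\<xi> i)) G' \<noteq> bot" using G' by (simp add: filtermap_bot_iff)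
  ultimately obtain z where z: "z \<in> C" "inf (nhds z) (filtermap (\<lambda>i. T (\<xi> i)) G') \<noteq> bot"
    using C unfolding compact_filter by blast
  define H where "H = inf (nhds z) (filtermap (\<lambda>i. T (\<xi> i)) G')"
  have "z \<noteq> T x"
  proof
    assume "z = T x"
    then have "\<forall>\<^sub>F y in nhds z. y \<in> S" using S by (auto simp: eventually_nhds)
    then have "\<forall>\<^sub>F y in H. y \<in> S" unfolding H_def by (rule filter_leD[OF inf_le1])
    moreover have "\<forall>\<^sub>F y in filtermap (\<lambda>i. T (\<xi> i)) G'. y \<notin> S"
      by (simp add: eventually_filtermap G'_def eventually_inf_principal)
    then have "\<forall>\<^sub>F y in H. y \<notin> S" unfolding H_def by (rule filter_leD[OF inf_le2])
    ultimately have "\<forall>\<^sub>F y in H. False" by eventually_elim blast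
    then show False using z(2) unfolding H_def trivial_limit_def by blast
  qed
  then obtain \<psi> where \<psi>: "\<psi> \<in> dual_space s norm UNIV" "\<psi> (z - T x) \<noteq> 0"
    using banach_over_functional_nonzero[OF banach_over_axioms, of "z - T x"] by auto
  note bl = dual_bounded_linear[OF \<psi>(1)]
  have "(\<psi> \<longlongrightarrow> \<psi> z) (nhds z)"
    by (rule bounded_linear.tendsto[OF bl filterlim_ident])
  then have 1: "(\<psi> \<longlongrightarrow> \<psi> z) H" unfolding H_def by (rule tendsto_mono[OF inf_le1])
  have d: "(\<lambda>x. \<psi> (T x)) \<in> dual_space s norm UNIV"
    by (rule dual_comp[OF \<psi>(1) lin compact_operator_bounded_linear[OF T]])
  have "((\<lambda>i. \<psi> (T (\<xi> i))) \<longlongrightarrow> \<psi> (T x)) G'"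
    by (rule tendsto_mono[OF G'(2)]) (rule weak[OF d])
  then have "(\<psi> \<longlongrightarrow> \<psi> (T x)) (filtermap (\<lambda>i. T (\<xi> i)) G')"
    unfolding filterlim_filtermap .
  then have 2: "(\<psi> \<longlongrightarrow> \<psi> (T x)) H" unfolding H_def by (rule tendsto_mono[OF inf_le2])
  have "\<psi> z = \<psi> (T x)" using tendsto_unique[OF _ 1 2] z(2) unfolding H_def by blast
  then show False using \<psi>(2) by (simp add: linear_diff[OF bounded_linear.linear[OF bl]])
qed

end

section \<open>The subspace of weakly continuous polynomials\<close>

context banach_pair
begin

lemma poly_space_add:
  assumes "P \<in> poly_space n sE sF" "Q \<in> poly_space n sE sF"
  shows "P + Q \<in> poly_space n sE sF"
proof -
  obtain A where A: "multilinear n sE sF A" "\<And>x. P x = A (\<lambda>_. x)" "continuous_on UNIV P"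
    by (rule poly_spaceE[OF assms(1)]) (rule that)
  obtain B where B: "multilinear n sE sF B" "\<And>x. Q x = B (\<lambda>_. x)" "continuous_on UNIV Q"
    by (rule poly_spaceE[OF assms(2)]) (rule that)
  show ?thesis
  proof (rule poly_spaceI[OF multilinear_add[OF A(1) B(1)]])
    show "(P + Q) x = A (\<lambda>_. x) + B (\<lambda>_. x)" for x by (simp add: A(2) B(2))
    show "continuous_on UNIV (P + Q)"
      unfolding plus_fun_def by (intro continuous_intros A(3) B(3))
  qed
qed

lemma bounded_linear_scale: "bounded_linear (sF c)"
  by (rule bounded_linear_intro[where K = "norm c"])
    (auto simp: F.norm_scale F.scale_right_distrib mult.commute F.scale_left_commute simp flip: F.scale_of_real)

lemma poly_space_comp_left:
  assumes P: "P \<in> poly_space n sE sF" and l: "Vector_Spaces.linear sF sG l" "bounded_linear l"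
  shows "(\<lambda>x. l (P x)) \<in> poly_space n sE sG"
proof -
  obtain A where A: "multilinear n sE sF A" "\<And>x. P x = A (\<lambda>_. x)" "continuous_on UNIV P"
    by (rule poly_spaceE[OF P]) (rule that)
  have "multilinear n sE sG (\<lambda>v. l (A v))"
    unfolding multilinear_def
  proof (intro conjI allI impI)
    show "l (A v) = l (A w)" if "\<forall>i<n. v i = w i" for v w
      using A(1) that unfolding multilinear_def by metis
    show "Vector_Spaces.linear sE sG (\<lambda>x. l (A (v(i := x))))" if "i < n" for i v
      using A(1) that l(1) unfolding multilinear_def Vector_Spaces.linear_iff by auto
  qed
  moreover have "continuous_on UNIV (\<lambda>x. l (P x))"
    by (rule bounded_linear.continuous_on[OF l(2) A(3)])
  ultimately show ?thesis
    unfolding poly_space_def using A(2) by (intro CollectI conjI exI[of _ "\<lambda>v. l (A v)"]) auto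
qed

lemma poly_space_scale: "P \<in> poly_space n sE sF \<Longrightarrow> poly_scale sF c P \<in> poly_space n sE sF"
  unfolding poly_scale_def
  by (rule poly_space_comp_left[OF _ _ bounded_linear_scale])
    (use F.vector_space_axioms in \<open>auto simp: Vector_Spaces.linear_iff F.scale_right_distrib F.scale_left_commute\<close>)

lemma poly_space_zero: "0 \<in> poly_space n sE sF"
  by (rule poly_spaceI[OF multilinear_zero]) (auto simp: zero_fun_def)

lemma poly_space_diff:
  assumes "P \<in> poly_space n sE sF" "Q \<in> poly_space n sE sF"
  shows "P - Q \<in> poly_space n sE sF"
proof -
  have "P + poly_scale sF (- 1) Q \<in> poly_space n sE sF"
    by (intro poly_space_add poly_space_scale assms)
  also have "P + poly_scale sF (- 1) Q = P - Q"
    by (rule ext) (simp add: poly_scale_def)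
  finally show ?thesis .
qed

lemma poly_space_comp_right:
  assumes P: "P \<in> poly_space n sE sF" and T: "Vector_Spaces.linear sE sE T" "bounded_linear T"
  shows "(\<lambda>x. P (T x)) \<in> poly_space n sE sF"
proof -
  obtain A where A: "multilinear n sE sF A" "\<And>x. P x = A (\<lambda>_. x)" "continuous_on UNIV P"
    by (rule poly_spaceE[OF P]) (rule that)
  have upd: "(\<lambda>j. T ((v(i := x)) j)) = (\<lambda>j. T (v j))(i := T x)" for v i x by auto
  have lin: "T (x + y) = T x + T y" "T (sE c x) = sE c (T x)" for x y c
    using T(1) unfolding Vector_Spaces.linear_iff by blast+
  have "multilinear n sE sF (\<lambda>v. A (\<lambda>i. T (v i)))"
  proof (rule multilinearI)
    show "A (\<lambda>i. T (v i)) = A (\<lambda>i. T (w i))" if "\<And>i. i < n \<Longrightarrow> v i = w i" for v w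
      by (rule multilinearD(1)[OF A(1)]) (simp add: that)
  qed (simp_all only: upd lin multilinearD(2,3)[OF A(1)])
  then show ?thesis
    by (rule poly_spaceI)
      (auto simp: A(2) intro!: continuous_on_compose2[OF A(3)] bounded_linear.continuous_on[OF T(2)] continuous_on_id
        simp flip: A(2))
qed

lemma weak_poly_space_subset: "weak_poly_space n sE sF \<subseteq> poly_space n sE sF"
  unfolding weak_poly_space_def by blast

text \<open>The definition speaks of filters on E; pushing an index filter forward along
  \<open>\<xi>\<close> gives the form used below, where the points depend on an index.\<close>

lemma weak_poly_spaceD:
  assumes u: "u \<in> weak_poly_space n sE sF" and bdd: "\<forall>\<^sub>F i in G. norm (\<xi> i) \<le> r"
    and weak: "\<And>\<phi>. \<phi> \<in> dual_space sE norm UNIV \<Longrightarrow> ((\<lambda>i. \<phi> (\<xi> i)) \<longlongrightarrow> \<phi> x) G"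
  shows "((\<lambda>i. u (\<xi> i)) \<longlongrightarrow> u x) G"
proof -
  have "\<exists>r. \<forall>\<^sub>F y in filtermap \<xi> G. norm y \<le> r"
    using bdd by (auto simp: eventually_filtermap)
  moreover have "\<forall>\<phi>\<in>dual_space sE norm UNIV. (\<phi> \<longlongrightarrow> \<phi> x) (filtermap \<xi> G)"
    using weak by (simp add: filterlim_filtermap)
  ultimately have "((\<lambda>y. norm (u y - u x)) \<longlongrightarrow> 0) (filtermap \<xi> G)"
    using u unfolding weak_poly_space_def weakly_continuous_on_bounded_sets_def by blast
  then have "((\<lambda>i. u (\<xi> i) - u x) \<longlongrightarrow> 0) G"
    by (simp add: filterlim_filtermap tendsto_norm_zero_iff)
  then show ?thesis by (simp add: LIM_zero_iff)
qed

lemma weak_poly_spaceI: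
  assumes "u \<in> poly_space n sE sF"
    and "\<And>G x r. \<forall>\<^sub>F y in G. norm y \<le> r \<Longrightarrow> (\<And>\<phi>. \<phi> \<in> dual_space sE norm UNIV \<Longrightarrow> (\<phi> \<longlongrightarrow> \<phi> x) G)
      \<Longrightarrow> (u \<longlongrightarrow> u x) G"
  shows "u \<in> weak_poly_space n sE sF"
  unfolding weak_poly_space_def weakly_continuous_on_bounded_sets_def
proof (intro CollectI conjI allI impI assms(1))
  fix G x assume *: "(\<exists>r. \<forall>\<^sub>F y in G. norm y \<le> r) \<and> (\<forall>\<phi>\<in>dual_space sE norm UNIV. (\<phi> \<longlongrightarrow> \<phi> x) G)"
  then obtain r where "\<forall>\<^sub>F y in G. norm y \<le> r" by blast
  then have "(u \<longlongrightarrow> u x) G" using * by (intro assms(2)) auto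
  then show "((\<lambda>y. norm (u y - u x)) \<longlongrightarrow> 0) G"
    by (intro tendsto_norm_zero) (simp add: LIM_zero)
qed

lemma weak_poly_space_degree_0: "poly_space 0 sE sF \<subseteq> weak_poly_space 0 sE sF"
proof
  fix u assume u: "u \<in> poly_space 0 sE sF"
  have "u = (\<lambda>_. u 0)" using poly_space_degree_0[OF u] by blast
  then show "u \<in> weak_poly_space 0 sE sF"
    using u by (intro weak_poly_spaceI) (metis tendsto_const)+
qed

lemma weak_poly_space_add:
  assumes "P \<in> weak_poly_space n sE sF" "Q \<in> weak_poly_space n sE sF"
  shows "P + Q \<in> weak_poly_space n sE sF"
proof (rule weak_poly_spaceI)
  show "P + Q \<in> poly_space n sE sF"
    using assms weak_poly_space_subset by (intro poly_space_add) auto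
  fix G x r
  assume G: "\<forall>\<^sub>F y in G. norm y \<le> r" "\<And>\<phi>. \<phi> \<in> dual_space sE norm UNIV \<Longrightarrow> (\<phi> \<longlongrightarrow> \<phi> x) G"
  show "(P + Q \<longlongrightarrow> (P + Q) x) G"
    using tendsto_add[OF weak_poly_spaceD[OF assms(1) G] weak_poly_spaceD[OF assms(2) G]]
    by (simp add: plus_fun_def)
qed

lemma weak_poly_space_scale:
  assumes "P \<in> weak_poly_space n sE sF"
  shows "poly_scale sF c P \<in> weak_poly_space n sE sF"
proof (rule weak_poly_spaceI)
  show "poly_scale sF c P \<in> poly_space n sE sF"
    using assms weak_poly_space_subset by (intro poly_space_scale) auto
  fix G x r
  assume G: "\<forall>\<^sub>F y in G. norm y \<le> r" "\<And>\<phi>. \<phi> \<in> dual_space sE norm UNIV \<Longrightarrow> (\<phi> \<longlongrightarrow> \<phi> x) G"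
  show "(poly_scale sF c P \<longlongrightarrow> poly_scale sF c P x) G"
    using bounded_linear.tendsto[OF bounded_linear_scale weak_poly_spaceD[OF assms G]]
    by (simp add: poly_scale_def)
qed

lemma weak_poly_space_closed:
  assumes P: "P \<in> poly_space n sE sF"
    and approx: "\<And>e. e > 0 \<Longrightarrow> \<exists>u\<in>weak_poly_space n sE sF. poly_norm (P - u) < e"
  shows "P \<in> weak_poly_space n sE sF"
proof (rule weak_poly_spaceI[OF P])
  fix G x r
  assume G: "\<forall>\<^sub>F y in G. norm y \<le> r" "\<And>\<phi>. \<phi> \<in> dual_space sE norm UNIV \<Longrightarrow> (\<phi> \<longlongrightarrow> \<phi> x) G"
  define R where "R = max r (norm x)"
  have R: "R \<ge> 0" "norm x \<le> R" "r \<le> R" by (auto simp: R_def le_max_iff_disj)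
  show "(P \<longlongrightarrow> P x) G"
  proof (rule tendstoI)
    fix e :: real assume e: "e > 0"
    have Rn: "R ^ n \<ge> 0" using R by simp
    \<comment> \<open>Each of three errors gets e / 3; the summand 1 keeps the denominator positive
      when R ^ n = 0.\<close>
    obtain u where u: "u \<in> weak_poly_space n sE sF" "poly_norm (P - u) < e / (3 * (R ^ n + 1))"
      using approx[of "e / (3 * (R ^ n + 1))"] e Rn by auto
    have Pu: "P - u \<in> poly_space n sE sF" using P u weak_poly_space_subset by (intro poly_space_diff) auto
    have small: "norm (P y - u y) < e / 3" if "norm y \<le> R" for y
    proof -
      have "norm (P y - u y) \<le> poly_norm (P - u) * norm y ^ n" using norm_le_poly_norm[OF Pu, of y] by simp
      also have "\<dots> \<le> poly_norm (P - u) * (R ^ n + 1)"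
        using power_mono[OF that, of n] by (intro mult_left_mono poly_norm_nonneg[OF Pu]) auto
      also have "\<dots> < e / (3 * (R ^ n + 1)) * (R ^ n + 1)"
        using u(2) Rn by (intro mult_strict_right_mono) auto
      also have "\<dots> = e / 3" using Rn by (simp add: divide_simps)
      finally show ?thesis .
    qed
    have "\<forall>\<^sub>F y in G. dist (u y) (u x) < e / 3"
      using weak_poly_spaceD[OF u(1) G] e by (intro tendstoD) auto
    with G(1) show "\<forall>\<^sub>F y in G. dist (P y) (P x) < e"
    proof eventually_elim
      case (elim y)
      have "norm (P y - P x) = norm ((P y - u y) + (u y - u x) - (P x - u x))" by simp
      then have "norm (P y - P x) \<le> norm (P y - u y) + norm (u y - u x) + norm (P x - u x)"
        using norm_triangle_ineq4[of "(P y - u y) + (u y - u x)" "P x - u x"]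
          norm_triangle_ineq[of "P y - u y" "u y - u x"] by linarith
      then show ?case using small[of y] small[of x] R elim by (simp add: dist_norm)
    qed
  qed
qed

text \<open>With the shift frozen at T x, the difference P(y) - P(y - T x) is a sum of polynomials
  of degree below n, hence weakly continuous. Replacing T x by T y changes it by a null net, because
  T y tends to T x in norm and \<open>P\<close> is Lipschitz at small distances on bounded
  sets.\<close>

lemma weak_poly_space_minus_comp:
  assumes P: "P \<in> poly_space n sE sF"
    and lower: "\<And>k. k < n \<Longrightarrow> poly_space k sE sF \<subseteq> weak_poly_space k sE sF"
    and T: "compact_operator sE T"
  shows "P - (\<lambda>x. P (x - T x)) \<in> weak_poly_space n sE sF"
proof (rule weak_poly_spaceI)
  have lin: "Vector_Spaces.linear sE sE T" using T unfolding compact_operator_def by blast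
  note bl = E.compact_operator_bounded_linear[OF T]
  have bl': "bounded_linear (\<lambda>x. x - T x)" using bounded_linear_sub[OF bounded_linear_ident bl] .
  have lin': "Vector_Spaces.linear sE sE (\<lambda>x. x - T x)"
    using lin unfolding Vector_Spaces.linear_iff by (auto simp: E.scale_right_diff_distrib)
  show "P - (\<lambda>x. P (x - T x)) \<in> poly_space n sE sF"
    by (rule poly_space_diff[OF P poly_space_comp_right[OF P lin' bl']])
  fix G x r
  assume G: "\<forall>\<^sub>F y in G. norm y \<le> r" "\<And>\<phi>. \<phi> \<in> dual_space sE norm UNIV \<Longrightarrow> (\<phi> \<longlongrightarrow> \<phi> x) G"
  have Tlim: "(T \<longlongrightarrow> T x) G" by (rule E.compact_operator_tendsto[OF T G])
  obtain c where c: "\<And>z. P z - P (z - T x) = (\<Sum>k<n. c k z)" "\<And>k. k < n \<Longrightarrow> c k \<in> poly_space k sE sF"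
    by (rule poly_space_translate[OF P, of "T x"]) (rule that)
  have lim: "((\<lambda>y. P y - P (y - T x)) \<longlongrightarrow> P x - P (x - T x)) G"
    unfolding c(1)
  proof (rule tendsto_sum)
    fix k assume "k \<in> {..<n}"
    then have "c k \<in> weak_poly_space k sE sF" using c(2) lower by blast
    then show "(c k \<longlongrightarrow> c k x) G" by (rule weak_poly_spaceD[OF _ G])
  qed
  obtain B where B: "\<And>z. norm (T z) \<le> norm z * B" "B > 0" using bounded_linear.pos_bounded[OF bl] by blast
  have "((\<lambda>y. P (y - T x) - P (y - T y)) \<longlongrightarrow> 0) G"
  proof (rule poly_space_diff_tendsto[OF P])
    show "\<forall>\<^sub>F y in G. norm (y - T x) \<le> \<bar>r\<bar> + norm (T x) + \<bar>r\<bar> * B"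
      using G(1)
    proof eventually_elim
      case (elim y)
      have "0 \<le> \<bar>r\<bar> * B" using B(2) by simp
      then show ?case using norm_triangle_ineq4[of y "T x"] elim by linarith
    qed
    show "\<forall>\<^sub>F y in G. norm (y - T y) \<le> \<bar>r\<bar> + norm (T x) + \<bar>r\<bar> * B"
      using G(1)
    proof eventually_elim
      case (elim y)
      have "norm y * B \<le> \<bar>r\<bar> * B" using B(2) elim by (intro mult_right_mono) auto
      then show ?case using norm_triangle_ineq4[of y "T y"] elim B(1)[of y] norm_ge_zero[of "T x"] by linarith
    qed
    show "((\<lambda>y. y - T x - (y - T y)) \<longlongrightarrow> 0) G"
      using Tlim by (simp add: LIM_zero)
  qed
  with lim have "((\<lambda>y. (P y - P (y - T x)) + (P (y - T x) - P (y - T y))) \<longlongrightarrow> P x - P (x - T x) + 0) G"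
    by (rule tendsto_add)
  then show "(P - (\<lambda>x. P (x - T x)) \<longlongrightarrow> (P - (\<lambda>x. P (x - T x))) x) G"
    by (simp add: fun_diff_def)
qed

end

section \<open>Uniformity on balls\<close>

lemma eventually_uniform_of_choice:
  fixes h :: "'i \<Rightarrow> 'a \<Rightarrow> 'f::real_normed_vector"
  assumes S: "S \<noteq> {}" and lim: "\<And>\<xi>. (\<And>i. \<xi> i \<in> S) \<Longrightarrow> ((\<lambda>i. h i (\<xi> i)) \<longlongrightarrow> 0) G" and e: "e > 0"
  shows "\<forall>\<^sub>F i in G. \<forall>x\<in>S. norm (h i x) < e"
proof -
  obtain z where z: "z \<in> S" using S by blast
  \<comment> \<open>A violating point is picked wherever there is one, so convergence along this
    single choice excludes violations eventually.\<close>
  define \<xi> where "\<xi> = (\<lambda>i. if \<exists>x\<in>S. \<not> norm (h i x) < e then SOME x. x \<in> S \<and> \<not> norm (h i x) < e else z)"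
  have some: "\<xi> i \<in> S \<and> \<not> norm (h i (\<xi> i)) < e" if "\<exists>x\<in>S. \<not> norm (h i x) < e" for i
  proof -
    have "\<exists>x. x \<in> S \<and> \<not> norm (h i x) < e" using that by blast
    from someI_ex[OF this] show ?thesis using that by (simp add: \<xi>_def)
  qed
  have "\<xi> i \<in> S" for i
    using some[of i] z by (cases "\<exists>x\<in>S. \<not> norm (h i x) < e") (auto simp: \<xi>_def)
  then have "((\<lambda>i. h i (\<xi> i)) \<longlongrightarrow> 0) G" by (rule lim)
  then have "\<forall>\<^sub>F i in G. dist (h i (\<xi> i)) 0 < e" using e by (rule tendstoD)
  then show ?thesis by (rule eventually_mono) (use some in auto)
qed

lemma compact_closure_finite_net:
  fixes S :: "'a::metric_space set"
  assumes "compact (closure S)" "d > 0"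
  obtains Y where "finite Y" "Y \<subseteq> closure S" "\<And>x. x \<in> S \<Longrightarrow> \<exists>y\<in>Y. dist y x < d"
proof -
  obtain Y where Y: "finite Y" "Y \<subseteq> closure S" "closure S \<subseteq> (\<Union>y\<in>Y. ball y d)"
    using compactE_image[OF assms(1), of "closure S" "\<lambda>y. ball y d"] assms(2)
    by (metis (no_types, lifting) UN_I centre_in_ball open_ball subsetI)
  have "\<exists>y\<in>Y. dist y x < d" if "x \<in> S" for x
    using subsetD[OF Y(3) subsetD[OF closure_subset that]] by auto
  then show thesis using that Y by blast
qed

text \<open>\<open>K_weak\<close> lets the points vary with the index: this is weak convergence of x
  - K x to 0, uniform on bounded sets, and stems from norm convergence of the adjoints at each
  functional.\<close>

locale compact_approximation = banach_pair sE sF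
  for sE :: "'k::rc_field \<Rightarrow> 'e::banach \<Rightarrow> 'e" and sF :: "'k \<Rightarrow> 'f::banach \<Rightarrow> 'f" +
  fixes G :: "'i filter" and K :: "'i \<Rightarrow> 'e \<Rightarrow> 'e" and M :: real
  assumes G: "G \<noteq> bot" and K: "\<And>i. compact_operator sE (K i)" and M: "M \<ge> 0"
    and K_le: "\<And>i x. norm (K i x) \<le> M * norm x"
    and K_weak: "\<And>\<phi> \<xi> r. \<phi> \<in> dual_space sE norm UNIV \<Longrightarrow> (\<And>i. norm (\<xi> i) \<le> r) \<Longrightarrow>
      ((\<lambda>i. \<phi> (\<xi> i) - \<phi> (K i (\<xi> i))) \<longlongrightarrow> 0) G"
begin

lemma minus_K_le: "norm (x - K i x) \<le> (1 + M) * norm x"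
  using norm_triangle_ineq4[of x "K i x"] K_le[of i x] by (simp add: algebra_simps)

lemma K_bounded:
  assumes "norm x \<le> r"
  shows "norm (K i x) \<le> (1 + M) * r" "norm (x - K i x) \<le> (1 + M) * r" "norm x \<le> (1 + M) * r"
proof -
  have r: "0 \<le> r" using assms norm_ge_zero order_trans by blast
  have 1: "(1 + M) * norm x \<le> (1 + M) * r" using assms M by (intro mult_left_mono) auto
  then show "norm (x - K i x) \<le> (1 + M) * r" using minus_K_le[of x i] by simp
  have "M * norm x \<ge> 0" using M by simp
  then show "norm x \<le> (1 + M) * r" "norm (K i x) \<le> (1 + M) * r"
    using 1 K_le[of i x] norm_ge_zero[of x] unfolding distrib_right by linarith+
qed

lemma dual_diff: "\<phi> \<in> dual_space sE norm UNIV \<Longrightarrow> \<phi> (x - y) = \<phi> x - \<phi> y"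
  by (rule linear_diff[OF bounded_linear.linear[OF E.dual_bounded_linear]])

lemma dual_0: "\<phi> \<in> dual_space sE norm UNIV \<Longrightarrow> \<phi> 0 = 0"
  by (rule linear_0[OF bounded_linear.linear[OF E.dual_bounded_linear]])

text \<open>For any choice of points in the ball, the differences
  \<open>\<xi> i - K i (\<xi> i)\<close> form a bounded net tending weakly to 0, and u(0) = 0 since
  the degree is positive.\<close>

lemma weak_poly_minus_K:
  assumes u: "u \<in> weak_poly_space n sE sF" and n: "n \<ge> 1" and e: "e > 0" and r: "r \<ge> 0"
  shows "\<forall>\<^sub>F i in G. \<forall>x\<in>cball 0 r. norm (u (x - K i x)) < e"
proof (rule eventually_uniform_of_choice[OF _ _ e])
  show "cball (0::'e) r \<noteq> {}" using r by simp
  fix \<xi> :: "'i \<Rightarrow> 'e" assume "\<And>i. \<xi> i \<in> cball 0 r"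
  then have \<xi>: "norm (\<xi> i) \<le> r" for i by simp
  have "((\<lambda>i. u (\<xi> i - K i (\<xi> i))) \<longlongrightarrow> u 0) G"
  proof (rule weak_poly_spaceD[OF u])
    show "\<forall>\<^sub>F i in G. norm (\<xi> i - K i (\<xi> i)) \<le> (1 + M) * r"
      using K_bounded(2)[OF \<xi>] by simp
    show "((\<lambda>i. \<phi> (\<xi> i - K i (\<xi> i))) \<longlongrightarrow> \<phi> 0) G" if "\<phi> \<in> dual_space sE norm UNIV" for \<phi>
      using K_weak[OF that \<xi>] by (simp add: dual_diff[OF that] dual_0[OF that])
  qed
  moreover have "u 0 = 0" using u n weak_poly_space_subset by (blast intro: poly_space_zero_at_0)
  ultimately show "((\<lambda>i. u (\<xi> i - K i (\<xi> i))) \<longlongrightarrow> 0) G" by simp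
qed

text \<open>
  Weak uniform continuity on bounded sets, by induction on the degree: \<open>u\<close> is a uniform limit on
  bounded sets of \<open>x \<mapsto> u x - u (x - K i x)\<close>, and the function \<open>x \<mapsto> u x - u (x - y)\<close> is
  a sum of polynomials of lower degree for each of the finitely many \<open>y\<close> of a net for the
  precompact set of the values \<open>K i x\<close>.
\<close>

lemma weak_poly_uniform:
  assumes lower: "\<And>k. k < n \<Longrightarrow> poly_space k sE sF \<subseteq> weak_poly_space k sE sF"
    and u: "u \<in> weak_poly_space n sE sF"
    and \<xi>: "\<And>i. norm (\<xi> i) \<le> r" and \<eta>: "\<And>i. norm (\<eta> i) \<le> r"
    and weak: "\<And>\<phi>. \<phi> \<in> dual_space sE norm UNIV \<Longrightarrow> ((\<lambda>i. \<phi> (\<eta> i) - \<phi> (\<xi> i)) \<longlongrightarrow> 0) G"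
  shows "((\<lambda>i. u (\<eta> i) - u (\<xi> i)) \<longlongrightarrow> 0) G"
  using lower u
proof (induction n arbitrary: u rule: less_induct)
  case (less n)
  have uP: "u \<in> poly_space n sE sF" using less.prems(2) weak_poly_space_subset by blast
  have r: "r \<ge> 0" using \<xi> norm_ge_zero order_trans by blast
  show ?case
  proof (cases "n = 0")
    case True
    then have "u x = u 0" for x using poly_space_degree_0 uP by blast
    then have "(\<lambda>i. u (\<eta> i) - u (\<xi> i)) = (\<lambda>_. 0)" by (metis diff_self)
    then show ?thesis by simp
  next
    case False
    then have n: "n \<ge> 1" by simp
    show ?thesis
    proof (rule tendstoI)
      fix e :: real assume e: "e > 0"
      \<comment> \<open>One index makes u(x - K x) small on the whole ball; from here on the compact
        operator \<open>T\<close> is fixed.\<close>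
      have "e / 4 > 0" using e by simp
      from eventually_happens'[OF G weak_poly_minus_K[OF less.prems(2) n this r]]
      obtain i0 where "\<forall>x\<in>cball 0 r. norm (u (x - K i0 x)) < e / 4" ..
      then have i0: "norm (u (x - K i0 x)) < e / 4" if "norm x \<le> r" for x using that by simp
      define R where "R = (1 + M) * r"
      define T where "T = K i0"
      have T: "compact_operator sE T" using K by (simp add: T_def)
      have TD: "T (x - y) = T x - T y" for x y
        by (rule linear_diff[OF bounded_linear.linear[OF E.compact_operator_bounded_linear[OF T]]])
      have T0: "T 0 = 0" using TD[of 0 0] by simp
      have "((\<lambda>i. T (\<xi> i - \<eta> i)) \<longlongrightarrow> T 0) G"
      proof (rule E.compact_operator_tendsto[OF T])
        show "\<forall>\<^sub>F i in G. norm (\<xi> i - \<eta> i) \<le> r + r"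
          using norm_triangle_le_diff[OF add_mono[OF \<xi> \<eta>]] by simp
        show "((\<lambda>i. \<phi> (\<xi> i - \<eta> i)) \<longlongrightarrow> \<phi> 0) G" if "\<phi> \<in> dual_space sE norm UNIV" for \<phi>
          using tendsto_minus[OF weak[OF that]] by (simp add: dual_diff[OF that] dual_0[OF that])
      qed
      then have Tlim: "((\<lambda>i. T (\<xi> i) - T (\<eta> i)) \<longlongrightarrow> 0) G" by (simp add: TD T0)
      \<comment> \<open>The shift by \<open>T (\<eta> i)\<close> is traded for that by
        \<open>T (\<xi> i)\<close>, so that one net point y serves both arguments.\<close>
      have 1: "((\<lambda>i. u (\<eta> i - T (\<eta> i)) - u (\<eta> i - T (\<xi> i))) \<longlongrightarrow> 0) G"
      proof (rule poly_space_diff_tendsto[OF uP, where r = "r + R"])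
        show "\<forall>\<^sub>F i in G. norm (\<eta> i - T (\<eta> i)) \<le> r + R"
          using norm_triangle_le_diff[OF add_mono[OF \<eta> K_bounded(1)[OF \<eta>]]] by (simp add: T_def R_def)
        show "\<forall>\<^sub>F i in G. norm (\<eta> i - T (\<xi> i)) \<le> r + R"
          using norm_triangle_le_diff[OF add_mono[OF \<eta> K_bounded(1)[OF \<xi>]]] by (simp add: T_def R_def)
        show "((\<lambda>i. \<eta> i - T (\<eta> i) - (\<eta> i - T (\<xi> i))) \<longlongrightarrow> 0) G"
          using Tlim by simp
      qed
      obtain B where B: "B \<ge> 0" "\<And>x y. norm x \<le> r + (R + 1) \<Longrightarrow> norm y \<le> r + (R + 1) \<Longrightarrow> norm (x - y) \<le> 1 \<Longrightarrow>
          norm (u x - u y) \<le> B * norm (x - y)"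
        by (rule poly_space_lipschitz[OF uP, of "r + (R + 1)"]) (rule that)
      \<comment> \<open>Moving a shift to a net point costs at most B d <= e / 16; d <= 1 stays in
        the range where the Lipschitz bound is valid, and B + 1 avoids division by 0.\<close>
      define d where "d = min 1 (e / (16 * (B + 1)))"
      have d: "d > 0" "d \<le> 1" "B * d \<le> e / 16"
      proof -
        show "d > 0" "d \<le> 1" using e B(1) by (auto simp: d_def)
        have "B * d \<le> B * (e / (16 * (B + 1)))" using B(1) by (intro mult_left_mono) (auto simp: d_def)
        also have "\<dots> \<le> (B + 1) * (e / (16 * (B + 1)))" using B(1) e by (intro mult_right_mono) auto
        also have "\<dots> = e / 16" using B(1) by (simp add: divide_simps)
        finally show "B * d \<le> e / 16" .
      qed
      \<comment> \<open>Compactness is given for the image of the unit ball and is rescaled to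
        radius \<open>r\<close>; r = 0 is separate because the rescaling divides by
        \<open>r\<close>.\<close>
      have cT: "compact (closure (T ` cball 0 r))"
      proof -
        have "closure (T ` cball 0 r) = (\<lambda>x. r *\<^sub>R x) ` closure (T ` cball 0 1)"
          if "r > 0"
        proof -
          have "cball (0::'e) r = (\<lambda>x. r *\<^sub>R x) ` cball 0 1"
          proof (intro equalityI subsetI)
            fix x :: 'e assume "x \<in> cball 0 r"
            then show "x \<in> (\<lambda>x. r *\<^sub>R x) ` cball 0 1"
              using that by (intro image_eqI[of _ _ "x /\<^sub>R r"]) (auto simp: field_simps)
          qed (use that mult_left_mono[of _ 1 r] in auto)
          then have "T ` cball 0 r = T ` ((\<lambda>x. r *\<^sub>R x) ` cball 0 1)" by simp
          also have "\<dots> = (\<lambda>x. r *\<^sub>R x) ` T ` cball 0 1"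
            using T unfolding compact_operator_def by (auto simp: image_image E.linear_scaleR)
          finally show ?thesis by (simp add: closure_scaleR)
        qed
        moreover have "T ` cball 0 r = {0}" if "r = 0" using that by (simp add: T0)
        ultimately show ?thesis
          using T r unfolding compact_operator_def by (cases "r = 0") (auto intro: compact_scaling)
      qed
      obtain Y where Y: "finite Y" "Y \<subseteq> closure (T ` cball 0 r)"
        "\<And>x. x \<in> T ` cball 0 r \<Longrightarrow> \<exists>y\<in>Y. dist y x < d"
        by (rule compact_closure_finite_net[OF cT d(1)]) (rule that)
      have Tb: "norm (T x) \<le> R" if "norm x \<le> r" for x
        using K_bounded(1)[OF that] by (simp add: T_def R_def)
      have YR: "norm y \<le> R" if "y \<in> Y" for y
      proof -
        have "closure (T ` cball 0 r) \<subseteq> cball 0 R"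
          by (rule closure_minimal) (auto simp: Tb)
        then show ?thesis using that Y(2) by auto
      qed
      have near: "norm ((u (z - T x)) - u (z - y)) \<le> e / 16"
        if "norm (T x) \<le> R" "y \<in> Y" "dist y (T x) < d" "norm z \<le> r" for x y z
      proof -
        have "norm ((z - T x) - (z - y)) < d" using that by (simp add: dist_norm)
        moreover have "norm (z - T x) \<le> r + (R + 1)" "norm (z - y) \<le> r + (R + 1)"
          using norm_triangle_ineq4[of z "T x"] norm_triangle_ineq4[of z y] that YR[OF that(2)] by linarith+
        ultimately have "norm (u (z - T x) - u (z - y)) \<le> B * norm ((z - T x) - (z - y))"
          using d(2) by (intro B(2)) auto
        also have "\<dots> \<le> B * d"
          using \<open>norm ((z - T x) - (z - y)) < d\<close> B(1) by (intro mult_left_mono) auto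
        finally show ?thesis using d(3) by simp
      qed
      have "\<forall>\<^sub>F i in G. \<forall>y\<in>Y. norm ((u (\<eta> i) - u (\<eta> i - y)) - (u (\<xi> i) - u (\<xi> i - y))) < e / 8"
      proof (intro eventually_ball_finite Y(1) ballI)
        fix y
        obtain c where c: "\<And>z. u z - u (z - y) = (\<Sum>k<n. c k z)" "\<And>k. k < n \<Longrightarrow> c k \<in> poly_space k sE sF"
          by (rule poly_space_translate[OF uP, of y]) (rule that)
        have "((\<lambda>i. \<Sum>k<n. c k (\<eta> i) - c k (\<xi> i)) \<longlongrightarrow> (\<Sum>k<n. 0)) G"
        proof (rule tendsto_sum)
          fix k assume k: "k \<in> {..<n}"
          then have "c k \<in> weak_poly_space k sE sF" using c(2) less.prems(1) by blast
          then show "((\<lambda>i. c k (\<eta> i) - c k (\<xi> i)) \<longlongrightarrow> 0) G"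
            using less.IH[of k "c k"] less.prems(1) k by (meson lessThan_iff less_trans)
        qed
        then have lim: "((\<lambda>i. (u (\<eta> i) - u (\<eta> i - y)) - (u (\<xi> i) - u (\<xi> i - y))) \<longlongrightarrow> 0) G"
          by (simp add: c(1) sum_subtractf)
        show "\<forall>\<^sub>F i in G. norm ((u (\<eta> i) - u (\<eta> i - y)) - (u (\<xi> i) - u (\<xi> i - y))) < e / 8"
          using tendstoD[OF lim, of "e / 8"] e by (simp add: dist_norm)
      qed
      moreover have "\<forall>\<^sub>F i in G. norm (u (\<eta> i - T (\<eta> i)) - u (\<eta> i - T (\<xi> i))) < e / 8"
        using tendstoD[OF 1, of "e / 8"] e by (simp add: dist_norm)
      ultimately show "\<forall>\<^sub>F i in G. dist (u (\<eta> i) - u (\<xi> i)) 0 < e"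
      proof eventually_elim
        case (elim i)
        have "T (\<xi> i) \<in> T ` cball 0 r" using \<xi> by simp
        then obtain y where y: "y \<in> Y" "dist y (T (\<xi> i)) < d" using Y(3) by blast
        have a: "norm ((u (\<eta> i) - u (\<eta> i - y)) - (u (\<xi> i) - u (\<xi> i - y))) < e / 8" using elim y by blast
        have b: "norm (u (\<eta> i - T (\<xi> i)) - u (\<eta> i - y)) \<le> e / 16"
          "norm (u (\<xi> i - T (\<xi> i)) - u (\<xi> i - y)) \<le> e / 16"
          using near[OF Tb[OF \<xi>] y] \<xi> \<eta> by auto
        have c: "norm (u (\<xi> i - T (\<xi> i))) < e / 4" "norm (u (\<eta> i - T (\<eta> i))) < e / 4"
          using i0 \<xi> \<eta> by (auto simp: T_def)
        let ?a = "(u (\<eta> i) - u (\<eta> i - y)) - (u (\<xi> i) - u (\<xi> i - y))"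
        let ?b = "u (\<eta> i - T (\<xi> i)) - u (\<eta> i - y)"
        let ?b' = "u (\<xi> i - T (\<xi> i)) - u (\<xi> i - y)"
        let ?g = "u (\<eta> i - T (\<eta> i)) - u (\<eta> i - T (\<xi> i))"
        \<comment> \<open>Telescoping through the shifts by y, \<open>T (\<xi> i)\<close> and
          \<open>T (\<eta> i)\<close>. The errors add up to e/8 + 2 e/16 + e/8 + 2 e/4 = 7
          e/8.\<close>
        have "u (\<eta> i) - u (\<xi> i) = ?a - ?b + ?b' - ?g + u (\<eta> i - T (\<eta> i)) - u (\<xi> i - T (\<xi> i))"
          by simp
        then have "norm (u (\<eta> i) - u (\<xi> i)) \<le>
          norm ?a + norm ?b + norm ?b' + norm ?g + norm (u (\<eta> i - T (\<eta> i))) + norm (u (\<xi> i - T (\<xi> i)))"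
          by (smt (verit) norm_triangle_ineq norm_triangle_ineq4)
        then have "norm (u (\<eta> i) - u (\<xi> i)) < e" using a b c elim(2) e by linarith
        then show ?case by (simp add: dist_norm)
      qed
    qed
  qed
qed

text \<open>Uniform continuity is applied to the pair of nets \<open>\<xi> i\<close> and
  \<open>K i (\<xi> i)\<close>, whose difference tends weakly to 0.\<close>

lemma weak_poly_comp_K:
  assumes lower: "\<And>k. k < n \<Longrightarrow> poly_space k sE sF \<subseteq> weak_poly_space k sE sF"
    and u: "u \<in> weak_poly_space n sE sF" and e: "e > 0" and r: "r \<ge> 0"
  shows "\<forall>\<^sub>F i in G. \<forall>x\<in>cball 0 r. norm (u x - u (K i x)) < e"
proof (rule eventually_uniform_of_choice[OF _ _ e])
  show "cball (0::'e) r \<noteq> {}" using r by simp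
  fix \<xi> :: "'i \<Rightarrow> 'e" assume "\<And>i. \<xi> i \<in> cball 0 r"
  then have \<xi>: "norm (\<xi> i) \<le> r" for i by simp
  show "((\<lambda>i. u (\<xi> i) - u (K i (\<xi> i))) \<longlongrightarrow> 0) G"
    by (rule weak_poly_uniform[OF lower u K_bounded(1)[OF \<xi>] K_bounded(3)[OF \<xi>] K_weak[OF _ \<xi>]])
qed

end

section \<open>The main theorem\<close>

lemma powr_add_le_add_powr:
  fixes a b r :: real
  assumes "0 \<le> a" "0 \<le> b" "1 \<le> r"
  shows "a powr r + b powr r \<le> (a + b) powr r"
proof (cases "a + b = 0")
  case True
  then have "a = 0" "b = 0" using assms by auto
  then show ?thesis using assms by simp
next
  case False
  then have pos: "a + b > 0" using assms by simp
  \<comment> \<open>Since r >= 1, one factor x can be kept while x^(r-1) grows to (a + b)^(r-1);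
    adding the instances for \<open>a\<close> and \<open>b\<close> completes one factor a +
    b.\<close>
  have le: "x powr r \<le> x * (a + b) powr (r - 1)" if "0 \<le> x" "x \<le> a + b" for x
  proof (cases "x = 0")
    case False
    then have "x powr r = x * x powr (r - 1)" using that powr_add[of x 1 "r - 1"] by simp
    also have "\<dots> \<le> x * (a + b) powr (r - 1)"
      using that assms by (intro mult_left_mono powr_mono2) auto
    finally show ?thesis .
  qed simp
  have "a powr r + b powr r \<le> a * (a + b) powr (r - 1) + b * (a + b) powr (r - 1)"
    using assms by (intro add_mono le) auto
  also have "\<dots> = (a + b) powr r"
    using powr_add[of "a + b" 1 "r - 1"] pos by (simp add: distrib_right)
  finally show ?thesis .
qed

text \<open>In the application \<open>s\<close>, \<open>t\<close> are the norms of K v and v - K v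
  for a vector v, \<open>x\<close>, \<open>y\<close> those of P(K v) and Q(v - K v),
  \<open>m\<close> is the larger polynomial norm and c = d = 1 + \<epsilon>. Raising the homogeneous
  bounds to the power q turns s^n into (s^p)^r with r = nq/p >= 1; superadditivity then brings in
  the bound on s^p + t^p.\<close>

lemma powr_power_estimate:
  fixes p q s t c d m x y z :: real
  assumes p: "1 < p" and q: "1 < q" and n: "n \<ge> 1" and pn: "p \<le> real n * q"
    and nonneg: "0 \<le> s" "0 \<le> t" "0 \<le> c" "0 \<le> d" "0 \<le> m" "0 \<le> x" "0 \<le> y" "0 \<le> z"
    and st: "s powr p + t powr p \<le> c powr p"
    and x: "x \<le> m * s ^ n" and y: "y \<le> m * t ^ n"
    and z: "z powr q \<le> d powr q * (x powr q + y powr q)"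
  shows "z \<le> d * m * c ^ n"
proof -
  define r where "r = real n * q / p"
  have r: "r \<ge> 1" "p * r = real n * q" using p pn by (simp_all add: r_def)
  have pw: "(w ^ n) powr q = (w powr p) powr r" if "w \<ge> 0" for w
    using that n by (simp add: powr_powr r powr_power mult.commute flip: powr_realpow')
  have le: "v powr q \<le> m powr q * (w powr p) powr r" if "0 \<le> v" "v \<le> m * w ^ n" "0 \<le> w" for v w
  proof -
    have "v powr q \<le> (m * w ^ n) powr q" using that q by (intro powr_mono2) auto
    also have "\<dots> = m powr q * (w ^ n) powr q" using that nonneg by (simp add: powr_mult)
    finally show ?thesis using pw that by simp
  qed
  have "x powr q + y powr q \<le> m powr q * (s powr p) powr r + m powr q * (t powr p) powr r"
    using nonneg x y by (intro add_mono le) auto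
  also have "\<dots> = m powr q * ((s powr p) powr r + (t powr p) powr r)" by (simp add: distrib_left)
  also have "\<dots> \<le> m powr q * (s powr p + t powr p) powr r"
    using r by (intro mult_left_mono powr_add_le_add_powr) auto
  also have "\<dots> \<le> m powr q * (c powr p) powr r"
    using r st by (intro mult_left_mono powr_mono2) auto
  also have "\<dots> = m powr q * (c ^ n) powr q" using pw nonneg by simp
  finally have "d powr q * (x powr q + y powr q) \<le> d powr q * (m powr q * (c ^ n) powr q)"
    by (intro mult_left_mono) auto
  also have "\<dots> = (d * m * c ^ n) powr q" using nonneg by (simp add: powr_mult mult.assoc)
  finally have "z powr q \<le> (d * m * c ^ n) powr q" using z by linarith
  moreover have "0 \<le> d * m * c ^ n" using nonneg by simp
  ultimately show ?thesis
    using powr_less_mono2[of q "d * m * c ^ n" z] q by linarith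
qed

text \<open>For each \<epsilon> the estimates hold at arbitrarily late indices, not eventually. The
  sets of late good indices form a filter base, since a later index and a smaller \<epsilon> meet
  two requirements at once; the resulting filter refines that of the tails, so limits along the net
  persist.\<close>

lemma frequently_net_filter:
  fixes good :: "real \<Rightarrow> 'i::preorder \<Rightarrow> bool"
  assumes directed: "directed TYPE('i)"
    and mono: "\<And>e e' i. good e i \<Longrightarrow> 0 < e \<Longrightarrow> e \<le> e' \<Longrightarrow> good e' i"
    and ex: "\<And>e a. e > 0 \<Longrightarrow> \<exists>b>a. good e b"
  obtains G where "G \<noteq> bot" "G \<le> net_filter" "\<And>e. e > 0 \<Longrightarrow> eventually (good e) G"
proof -
  define I :: "('i \<times> real) set" where "I = UNIV \<times> {0<..}"
  define T where "T = (\<lambda>(a, e). {b. a \<le> b \<and> good e b})"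
  define G where "G = (INF z\<in>I. principal (T z))"
  have base: "\<exists>z\<in>I. principal (T z) \<le> inf (principal (T x)) (principal (T y))" if "x \<in> I" "y \<in> I" for x y
  proof -
    obtain a e b e' where xy: "x = (a, e)" "y = (b, e')" by (cases x; cases y)
    have e: "e > 0" "e' > 0" using that xy by (auto simp: I_def)
    obtain c where c: "a \<le> c" "b \<le> c" using directed unfolding directed_def by blast
    have "T (c, min e e') \<subseteq> T x \<inter> T y"
      unfolding T_def xy using c mono[of "min e e'" _ e] mono[of "min e e'" _ e'] e
      by (auto intro: order_trans)
    then show ?thesis using e by (intro bexI[of _ "(c, min e e')"]) (auto simp: I_def)
  qed
  have "I \<noteq> {}" using gt_ex[of "0::real"] by (auto simp: I_def)
  then have ev: "eventually P G \<longleftrightarrow> (\<exists>z\<in>I. eventually P (principal (T z)))" for P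
    unfolding G_def using base by (intro eventually_INF_base) auto
  have "T z \<noteq> {}" if zI: "z \<in> I" for z
  proof -
    obtain a e where z: "z = (a, e)" "e > 0" using zI by (auto simp: I_def)
    then obtain b where "b > a" "good e b" using ex by blast
    then show ?thesis using z by (auto simp: T_def intro: less_imp_le)
  qed
  then have "G \<noteq> bot"
    unfolding trivial_limit_def ev by (auto simp: eventually_principal)
  moreover have "G \<le> net_filter"
    unfolding net_filter_def
  proof (rule INF_greatest)
    fix a
    have "G \<le> principal (T (a, 1))" unfolding G_def by (rule INF_lower) (simp add: I_def)
    also have "\<dots> \<le> principal {a..}" by (auto simp: T_def)
    finally show "G \<le> principal {a..}" .
  qed
  moreover have "eventually (good e) G" if "e > 0" for e
    unfolding ev using that
    by (intro bexI[of _ "(undefined, e)"]) (auto simp: I_def T_def eventually_principal)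
  ultimately show thesis by (rule that)
qed

section \<open>Critical degrees and composition with compact operators\<close>

lemma weak_poly_space_below_critical_degree:
  assumes "1 \<le> k" "enat k < critical_degree sE sF"
  shows "weak_poly_space k sE sF = poly_space k sE sF"
proof (rule ccontr)
  assume "\<not> ?thesis"
  then have "critical_degree sE sF \<le> enat k"
    unfolding critical_degree_def using assms(1) by (intro Inf_lower) auto
  then show False using assms(2) by simp
qed

lemma critical_degree_ge_1:
  assumes "enat n = critical_degree sE sF"
  shows "n \<ge> 1"
proof -
  let ?S = "{enat k | k. k \<ge> 1 \<and> weak_poly_space k sE sF \<noteq> poly_space k sE sF}"
  have "enat n = Inf ?S" using assms unfolding critical_degree_def .
  moreover have "enat 1 \<le> Inf ?S" by (rule Inf_greatest) auto
  ultimately have "enat 1 \<le> enat n" by simp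
  then show ?thesis by simp
qed

text \<open>This is where n < cd(E) enters: for each functional \<psi> the scalar polynomial x ->
  \<psi>(P x) is weakly continuous, so P y stays bounded and tends weakly to P x; the compact
  \<open>L\<close> improves this to norm convergence.\<close>

lemma (in banach_pair) compact_comp_poly_space:
  assumes P: "P \<in> poly_space n sE sF" and L: "compact_operator sF L" and n: "n \<ge> 1"
    and scalar: "weak_poly_space n sE ((*) :: 'k \<Rightarrow> 'k \<Rightarrow> 'k) = poly_space n sE (*)"
  shows "(\<lambda>x. L (P x)) \<in> weak_poly_space n sE sF"
proof (rule weak_poly_spaceI)
  have lin: "Vector_Spaces.linear sF sF L" using L unfolding compact_operator_def by blast
  show "(\<lambda>x. L (P x)) \<in> poly_space n sE sF"
    by (rule poly_space_comp_left[OF P lin F.compact_operator_bounded_linear[OF L]])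
  fix G x r
  assume G: "\<forall>\<^sub>F y in G. norm y \<le> r" "\<And>\<phi>. \<phi> \<in> dual_space sE norm UNIV \<Longrightarrow> (\<phi> \<longlongrightarrow> \<phi> x) G"
  obtain C where C: "C \<ge> 0" "\<And>x. norm (P x) \<le> C * norm x ^ n"
    by (rule poly_space_bounded[OF P]) (rule that)
  show "((\<lambda>y. L (P y)) \<longlongrightarrow> L (P x)) G"
  proof (rule F.compact_operator_tendsto[OF L])
    show "\<forall>\<^sub>F y in G. norm (P y) \<le> C * r ^ n"
      using G(1)
    proof eventually_elim
      case (elim y)
      have "C * norm y ^ n \<le> C * r ^ n" using elim C(1) by (intro mult_left_mono power_mono) auto
      then show ?case using C(2)[of y] by linarith
    qed
    fix \<psi> assume \<psi>: "\<psi> \<in> dual_space sF norm UNIV"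
    have vs: "vector_space ((*) :: 'k \<Rightarrow> 'k \<Rightarrow> 'k)"
      by unfold_locales (auto simp: algebra_simps)
    have "Vector_Spaces.linear sF (*) \<psi>"
      using \<psi> vs F.vector_space_axioms unfolding Vector_Spaces.linear_iff dual_space_def by auto
    then have "(\<lambda>x. \<psi> (P x)) \<in> poly_space n sE (*)"
      by (rule poly_space_comp_left[OF P _ F.dual_bounded_linear[OF \<psi>]])
    then have "weakly_continuous_on_bounded_sets sE (\<lambda>x. \<psi> (P x))"
      using scalar unfolding weak_poly_space_def by blast
    then have "((\<lambda>y. norm (\<psi> (P y) - \<psi> (P x))) \<longlongrightarrow> 0) G"
      using G unfolding weakly_continuous_on_bounded_sets_def by blast
    then show "((\<lambda>y. \<psi> (P y)) \<longlongrightarrow> \<psi> (P x)) G"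
      by (simp add: tendsto_norm_zero_iff LIM_zero_iff)
  qed
qed

text \<open>Here compactness acts before \<open>P\<close>: T y tends to T x in norm, and the norm
  continuity of \<open>P\<close> finishes.\<close>

lemma (in banach_pair) compact_comp_right_poly_space:
  assumes P: "P \<in> poly_space n sE sF" and T: "compact_operator sE T"
    and L: "Vector_Spaces.linear sF sF L" "bounded_linear L"
  shows "(\<lambda>x. L (P (T x))) \<in> weak_poly_space n sE sF"
proof (rule weak_poly_spaceI)
  have lin: "Vector_Spaces.linear sE sE T" using T unfolding compact_operator_def by blast
  show "(\<lambda>x. L (P (T x))) \<in> poly_space n sE sF"
    by (intro poly_space_comp_left[OF _ L] poly_space_comp_right[OF P lin E.compact_operator_bounded_linear[OF T]])
  fix G x r
  assume G: "\<forall>\<^sub>F y in G. norm y \<le> r" "\<And>\<phi>. \<phi> \<in> dual_space sE norm UNIV \<Longrightarrow> (\<phi> \<longlongrightarrow> \<phi> x) G"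
  have "continuous_on UNIV P" by (rule poly_spaceE[OF P])
  then have "((\<lambda>y. P (T y)) \<longlongrightarrow> P (T x)) G"
    using E.compact_operator_tendsto[OF T G] by (rule continuous_on_tendsto_compose) auto
  then show "((\<lambda>y. L (P (T y))) \<longlongrightarrow> L (P (T x))) G"
    by (rule bounded_linear.tendsto[OF L(2)])
qed

lemma (in banach_over) compact_net_bound:
  assumes "bounded_compact_net s T"
  obtains M where "M \<ge> 0" "\<And>i x. norm (T i x) \<le> M * norm x"
proof -
  obtain M where T: "\<And>i. compact_operator s (T i)" and M: "\<And>i. onorm (T i) \<le> M"
    using assms unfolding bounded_compact_net_def by blast
  have bl: "bounded_linear (T i)" for i by (rule compact_operator_bounded_linear[OF T])
  have "M \<ge> 0" using onorm_pos_le[OF bl] M order_trans by blast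
  moreover have "norm (T i x) \<le> M * norm x" for i x
    using onorm[OF bl, of i x] mult_right_mono[OF M norm_ge_zero, of i x] by linarith
  ultimately show thesis using that by blast
qed

text \<open>Up to sign, the difference is the functional
  \<open>adjoint_map (K i) \<phi> - \<phi>\<close> at a point of norm at most \<open>r\<close>, so
  its dual norm controls all choices of points at once.\<close>

lemma (in banach_over) dual_norm_adjoint_tendsto:
  assumes K: "\<And>i. compact_operator s (K i)"
    and lim: "((\<lambda>i. dual_norm norm UNIV (adjoint_map (K i) \<phi> - \<phi>)) \<longlongrightarrow> 0) G"
    and \<phi>: "\<phi> \<in> dual_space s norm UNIV" and \<xi>: "\<And>i. norm (\<xi> i) \<le> r"
  shows "((\<lambda>i. \<phi> (\<xi> i) - \<phi> (K i (\<xi> i))) \<longlongrightarrow> 0) G"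
proof -
  interpret N: seminormed_carrier s norm UNIV by (rule seminormed_carrier_UNIV)
  define \<rho> where "\<rho> = (\<lambda>i. dual_norm norm UNIV (adjoint_map (K i) \<phi> - \<phi>))"
  have d: "adjoint_map (K i) \<phi> - \<phi> \<in> dual_space s norm UNIV" for i
  proof (rule N.dual_minus[OF _ \<phi>])
    have "Vector_Spaces.linear s s (K i)" using K unfolding compact_operator_def by blast
    from dual_comp[OF \<phi> this compact_operator_bounded_linear[OF K]]
    show "adjoint_map (K i) \<phi> \<in> dual_space s norm UNIV" by (simp add: adjoint_map_def comp_def)
  qed
  have le: "norm (\<phi> (\<xi> i) - \<phi> (K i (\<xi> i))) \<le> \<rho> i * r" for i
  proof -
    have "norm (\<phi> (\<xi> i) - \<phi> (K i (\<xi> i))) \<le> \<rho> i * norm (\<xi> i)"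
      using N.norm_le_dual_norm_times[OF d, of "\<xi> i" i]
      by (simp add: adjoint_map_def \<rho>_def norm_minus_commute)
    also have "\<dots> \<le> \<rho> i * r"
      using N.dual_norm_nonneg[OF d, of i] \<xi> by (intro mult_left_mono) (auto simp: \<rho>_def)
    finally show ?thesis .
  qed
  have "((\<lambda>i. \<rho> i * r) \<longlongrightarrow> 0) G"
    using tendsto_mult_right[OF lim, of r] by (simp add: \<rho>_def)
  then show ?thesis by (rule Lim_null_comparison[OF always_eventually[OF allI[OF le]]])
qed

theorem theorem2p6:
  fixes sE :: "'k::rc_field \<Rightarrow> 'e::banach \<Rightarrow> 'e"
    and sF :: "'k \<Rightarrow> 'f::banach \<Rightarrow> 'f"
    and K :: "'i::preorder \<Rightarrow> 'e \<Rightarrow> 'e"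
    and L :: "'j::preorder \<Rightarrow> 'f \<Rightarrow> 'f"
    and p q :: real and n :: nat
  assumes E: "banach_over sE" and F: "banach_over sF"
    and directed: "directed TYPE('i)" "directed TYPE('j)"
    and K: "bounded_compact_net sE K"
    and L: "bounded_compact_net sF L"
    and p: "1 < p" and q: "1 < q"
    and K_adjoint: "\<And>f. f \<in> dual_space sE norm UNIV \<Longrightarrow>
          ((\<lambda>\<alpha>. dual_norm norm UNIV (adjoint_map (K \<alpha>) f - f)) \<longlongrightarrow> 0) net_filter"
    and L_pointwise: "\<And>y. ((\<lambda>\<beta>. L \<beta> y) \<longlongrightarrow> y) net_filter"
    and K_p: "\<And>\<epsilon> \<alpha>\<^sub>0. \<epsilon> > 0 \<Longrightarrow> \<exists>\<alpha>>\<alpha>\<^sub>0. \<forall>x.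
          norm (K \<alpha> x) powr p + norm (x - K \<alpha> x) powr p \<le> (1 + \<epsilon>) powr p * norm x powr p"
    and L_q: "\<And>\<epsilon> \<beta>\<^sub>0. \<epsilon> > 0 \<Longrightarrow> \<exists>\<beta>>\<beta>\<^sub>0. \<forall>y\<^sub>1 y\<^sub>2.
          norm (L \<beta> y\<^sub>1 + (y\<^sub>2 - L \<beta> y\<^sub>2)) powr q
            \<le> (1 + \<epsilon>) powr q * (norm y\<^sub>1 powr q + norm y\<^sub>2 powr q)"
    and n_cd: "enat n = critical_degree sE sF"
    and p_le: "p \<le> real n * q"
    and n_less: "enat n < critical_degree sE ((*) :: 'k \<Rightarrow> 'k \<Rightarrow> 'k)"
  shows "M_ideal (poly_scale sF) poly_norm (poly_space n sE sF) (weak_poly_space n sE sF)"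
proof -
  interpret banach_pair sE sF
    using E F by (simp add: banach_pair_def)
  have n: "n \<ge> 1" using critical_degree_ge_1[OF n_cd] .
  \<comment> \<open>Degree 0 lies outside the definition of the critical degree; polynomials of
    degree 0 are constant.\<close>
  have lower: "poly_space k sE sF \<subseteq> weak_poly_space k sE sF" if "k < n" for k
  proof (cases "k = 0")
    case True
    then show ?thesis using weak_poly_space_degree_0 by simp
  next
    case False
    then show ?thesis
      using weak_poly_space_below_critical_degree[of k sE sF] that by (simp flip: n_cd)
  qed
  have scalar: "weak_poly_space n sE ((*) :: 'k \<Rightarrow> 'k \<Rightarrow> 'k) = poly_space n sE (*)"
    by (rule weak_poly_space_below_critical_degree[OF n n_less])
  have Kc: "compact_operator sE (K i)" for i using K unfolding bounded_compact_net_def by blast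
  have Lc: "compact_operator sF (L j)" for j using L unfolding bounded_compact_net_def by blast
  obtain M where M: "M \<ge> 0" "\<And>i x. norm (K i x) \<le> M * norm x"
    by (rule E.compact_net_bound[OF K]) (rule that)
  obtain M' where M': "M' \<ge> 0" "\<And>j y. norm (L j y) \<le> M' * norm y"
    by (rule F.compact_net_bound[OF L]) (rule that)
  define goodK where "goodK = (\<lambda>\<epsilon> i. \<forall>x. norm (K i x) powr p + norm (x - K i x) powr p
    \<le> (1 + \<epsilon>) powr p * norm x powr p)"
  define goodL where "goodL = (\<lambda>\<epsilon> j. \<forall>y\<^sub>1 y\<^sub>2. norm (L j y\<^sub>1 + (y\<^sub>2 - L j y\<^sub>2)) powr q
    \<le> (1 + \<epsilon>) powr q * (norm y\<^sub>1 powr q + norm y\<^sub>2 powr q))"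
  have K_mono: "goodK e' i" if "goodK e i" "0 < e" "e \<le> e'" for e e' i
  proof -
    have "(1 + e) powr p * norm x powr p \<le> (1 + e') powr p * norm x powr p" for x :: 'e
      using that p by (intro mult_right_mono powr_mono2) auto
    then show ?thesis using that(1) unfolding goodK_def by (meson order_trans)
  qed
  have L_mono: "goodL e' j" if "goodL e j" "0 < e" "e \<le> e'" for e e' j
  proof -
    have "(1 + e) powr q * (norm y powr q + norm z powr q) \<le> (1 + e') powr q * (norm y powr q + norm z powr q)"
      for y z :: 'f
      using that q by (intro mult_right_mono powr_mono2) auto
    then show ?thesis using that(1) unfolding goodL_def by (meson order_trans)
  qed
  obtain GK where GK: "GK \<noteq> bot" "GK \<le> net_filter" "\<And>e. e > 0 \<Longrightarrow> eventually (goodK e) GK"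
    by (rule frequently_net_filter[OF directed(1), of goodK, OF K_mono]) (use K_p in \<open>auto simp: goodK_def intro: that\<close>)
  obtain GL where GL: "GL \<noteq> bot" "GL \<le> net_filter" "\<And>e. e > 0 \<Longrightarrow> eventually (goodL e) GL"
    by (rule frequently_net_filter[OF directed(2), of goodL, OF L_mono]) (use L_q in \<open>auto simp: goodL_def intro: that\<close>)
  interpret compact_approximation sE sF GK K M
  proof unfold_locales
    show "((\<lambda>i. \<phi> (\<xi> i) - \<phi> (K i (\<xi> i))) \<longlongrightarrow> 0) GK"
      if "\<phi> \<in> dual_space sE norm UNIV" "\<And>i. norm (\<xi> i) \<le> r" for \<phi> \<xi> r
      by (rule E.dual_norm_adjoint_tendsto[OF Kc tendsto_mono[OF GK(2) K_adjoint[OF that(1)]] that])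
  qed (use GK Kc M in auto)
  \<comment> \<open>The operators K and L have unrelated index sets; the product filter makes good
    indices for both available together.\<close>
  obtain U where U: "U \<noteq> bot" "U \<le> GK \<times>\<^sub>F GL" "\<And>P. eventually P U \<or> eventually (\<lambda>x. \<not> P x) U"
    using ultrafilter_refinement[of "GK \<times>\<^sub>F GL"] GK(1) GL(1) by (auto simp: prod_filter_eq_bot)
  have evU: "\<forall>\<^sub>F z in U. P (fst z) \<and> Q (snd z)" if "eventually P GK" "eventually Q GL" for P Q
    using eventually_prodI[OF that] filter_leD[OF U(2)] by (simp add: case_prod_beta)
  define A where "A = (\<lambda>z (P :: 'e \<Rightarrow> 'f) x. L (snd z) (P (K (fst z) x)))"
  define B where "B = (\<lambda>z (P :: 'e \<Rightarrow> 'f) x. P (x - K (fst z) x) - L (snd z) (P (x - K (fst z) x)))"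
  have Llin: "Vector_Spaces.linear sF sF (L j)" for j using Lc unfolding compact_operator_def by blast
  have Lbl: "bounded_linear (L j)" for j by (rule F.compact_operator_bounded_linear[OF Lc])
  have L_add: "L j (x + y) = L j x + L j y" and L_scale: "L j (sF c x) = sF c (L j x)"
    and L_diff: "L j (x - y) = L j x - L j y" for j c x y
    using Llin[of j] linear_diff[OF bounded_linear.linear[OF Lbl]] unfolding Vector_Spaces.linear_iff by auto
  have vs: "vector_space (poly_scale sF :: 'k \<Rightarrow> ('e \<Rightarrow> 'f) \<Rightarrow> _)"
    by unfold_locales (auto simp: poly_scale_def fun_eq_iff F.scale_right_distrib F.scale_left_distrib)
  interpret V: vector_space "poly_scale sF :: 'k \<Rightarrow> ('e \<Rightarrow> 'f) \<Rightarrow> 'e \<Rightarrow> 'f" by (rule vs)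
  \<comment> \<open>One factor 1 + e comes from L, and n more come from K through
    homogeneity.\<close>
  have norm_AB: "norm ((A z P + B z Q) x) \<le> (1 + e) * max (poly_norm P) (poly_norm Q) * (1 + e) ^ n"
    if good: "goodK e (fst z)" "goodL e (snd z)" and e: "e > 0"
      and P: "P \<in> poly_space n sE sF" and Q: "Q \<in> poly_space n sE sF" and x: "norm x \<le> 1" for z P Q x e
  proof -
    let ?y = "P (K (fst z) x)" and ?y' = "Q (x - K (fst z) x)"
    define m where "m = max (poly_norm P) (poly_norm Q)"
    have m: "m \<ge> 0" using poly_norm_nonneg[OF P] by (simp add: m_def le_max_iff_disj)
    have "norm (L (snd z) ?y + (?y' - L (snd z) ?y')) \<le> (1 + e) * m * (1 + e) ^ n"
    proof (rule powr_power_estimate[OF p q n p_le])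
      have "norm (K (fst z) x) powr p + norm (x - K (fst z) x) powr p \<le> (1 + e) powr p * norm x powr p"
        using good(1) unfolding goodK_def by blast
      also have "\<dots> \<le> (1 + e) powr p * 1"
        using x p powr_mono2[of p "norm x" 1] by (intro mult_left_mono) auto
      finally show "norm (K (fst z) x) powr p + norm (x - K (fst z) x) powr p \<le> (1 + e) powr p" by simp
      show "norm ?y \<le> m * norm (K (fst z) x) ^ n"
        by (rule order_trans[OF norm_le_poly_norm[OF P]]) (auto intro!: mult_right_mono simp: m_def)
      show "norm ?y' \<le> m * norm (x - K (fst z) x) ^ n"
        by (rule order_trans[OF norm_le_poly_norm[OF Q]]) (auto intro!: mult_right_mono simp: m_def)
      show "norm (L (snd z) ?y + (?y' - L (snd z) ?y')) powr q
          \<le> (1 + e) powr q * (norm ?y powr q + norm ?y' powr q)"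
        using good(2) unfolding goodL_def by blast
    qed (use e m in auto)
    then show ?thesis by (simp add: A_def B_def m_def)
  qed
  have B_poly: "B z P \<in> poly_space n sE sF" and B_weak: "P - B z P \<in> weak_poly_space n sE sF"
    if P: "P \<in> poly_space n sE sF" for z P
  proof -
    let ?T = "\<lambda>x. x - K (fst z) x"
    have Tbl: "bounded_linear ?T"
      using bounded_linear_sub[OF bounded_linear_ident E.compact_operator_bounded_linear[OF Kc]] .
    have Tlin: "Vector_Spaces.linear sE sE ?T"
      using Kc[of "fst z"] unfolding compact_operator_def Vector_Spaces.linear_iff
      by (auto simp: E.scale_right_diff_distrib)
    have PT: "(\<lambda>x. P (?T x)) \<in> poly_space n sE sF" by (rule poly_space_comp_right[OF P Tlin Tbl])
    have LPT: "(\<lambda>x. L (snd z) (P (?T x))) \<in> weak_poly_space n sE sF"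
      by (rule compact_comp_poly_space[OF PT Lc n scalar])
    have eq: "B z P = (\<lambda>x. P (?T x)) - (\<lambda>x. L (snd z) (P (?T x)))" by (auto simp: B_def)
    then show "B z P \<in> poly_space n sE sF"
      using poly_space_diff[OF PT] LPT weak_poly_space_subset by auto
    \<comment> \<open>The first summand is weakly continuous by the degree drop, the second by n <
      cd(E) and the compactness of L.\<close>
    have eq': "P - B z P = (P - (\<lambda>x. P (?T x))) + (\<lambda>x. L (snd z) (P (?T x)))"
      unfolding eq by simp
    show "P - B z P \<in> weak_poly_space n sE sF"
      unfolding eq' by (rule weak_poly_space_add[OF weak_poly_space_minus_comp[OF P lower Kc] LPT])
  qed
  have A_weak: "A z P \<in> weak_poly_space n sE sF" if P: "P \<in> poly_space n sE sF" for z P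
    unfolding A_def by (rule compact_comp_right_poly_space[OF P Kc Llin Lbl])
  have limI: "((\<lambda>z. poly_norm (C z)) \<longlongrightarrow> 0) U"
    if C: "\<And>z. C z \<in> poly_space n sE sF"
      and ev: "\<And>e. e > 0 \<Longrightarrow> \<forall>\<^sub>F z in U. \<forall>x. norm x \<le> 1 \<longrightarrow> norm (C z x) \<le> e" for C
  proof (rule tendstoI)
    fix e :: real assume e: "e > 0"
    have "\<forall>\<^sub>F z in U. \<forall>x. norm x \<le> 1 \<longrightarrow> norm (C z x) \<le> e / 2" using e by (intro ev) simp
    then show "\<forall>\<^sub>F z in U. dist (poly_norm (C z)) 0 < e"
    proof eventually_elim
      case (elim z)
      then have "poly_norm (C z) \<le> e / 2" by (intro poly_norm_least) blast
      then show ?case using poly_norm_nonneg[OF C, of z] e by (simp add: dist_norm)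
    qed
  qed
  have B_lim: "((\<lambda>z. poly_norm (B z u)) \<longlongrightarrow> 0) U" if u: "u \<in> weak_poly_space n sE sF" for u
  proof (rule limI)
    have uP: "u \<in> poly_space n sE sF" using u weak_poly_space_subset by blast
    then show "B z u \<in> poly_space n sE sF" for z by (rule B_poly)
    fix e :: real assume e: "e > 0"
    \<comment> \<open>Id - L increases norms by at most the factor 1 + M'.\<close>
    define d where "d = e / (1 + M')"
    have d: "d > 0" "(1 + M') * d = e" using e M' by (auto simp: d_def)
    have "\<forall>\<^sub>F i in GK. \<forall>x\<in>cball 0 1. norm (u (x - K i x)) < d"
      by (rule weak_poly_minus_K[OF u n d(1)]) simp
    from evU[OF this, of "\<lambda>_. True"]
    have "\<forall>\<^sub>F z in U. \<forall>x\<in>cball 0 1. norm (u (x - K (fst z) x)) < d" by simp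
    then show "\<forall>\<^sub>F z in U. \<forall>x. norm x \<le> 1 \<longrightarrow> norm (B z u x) \<le> e"
    proof (eventually_elim, intro allI impI)
      fix z :: "'i \<times> 'j" and x :: 'e assume *: "\<forall>x\<in>cball 0 1. norm (u (x - K (fst z) x)) < d" and x: "norm x \<le> 1"
      let ?w = "u (x - K (fst z) x)"
      have "norm ?w \<le> d" using * x by (auto intro: less_imp_le)
      then have "(1 + M') * norm ?w \<le> (1 + M') * d" using M' by (intro mult_left_mono) auto
      then show "norm (B z u x) \<le> e"
        using norm_triangle_ineq4[of ?w "L (snd z) ?w"] M'(2)[of "snd z" ?w] d(2)
        by (simp add: B_def algebra_simps)
    qed
  qed
  have A_lim: "((\<lambda>z. poly_norm (A z u - u)) \<longlongrightarrow> 0) U" if u: "u \<in> weak_poly_space n sE sF" for u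
  proof (rule limI)
    have uP: "u \<in> poly_space n sE sF" using u weak_poly_space_subset by blast
    then show "A z u - u \<in> poly_space n sE sF" for z
      by (intro poly_space_diff subsetD[OF weak_poly_space_subset A_weak])
    fix e :: real assume e: "e > 0"
    \<comment> \<open>The errors are 3 M' d from L applied to a vector of norm at most 3 d, then d
      and 2 d; one further d is slack.\<close>
    define d where "d = e / (3 * M' + 4)"
    have d: "d > 0" "(3 * M' + 4) * d = e" using e M' by (auto simp: d_def)
    have evK: "\<forall>\<^sub>F i in GK. \<forall>x\<in>cball 0 1. norm (u x - u (K i x)) < d"
      by (rule weak_poly_comp_K[OF lower u d(1)]) simp_all
    \<comment> \<open>Pointwise convergence of L is uniform on finite sets. One fixed
      \<open>K i0\<close> brings the values of \<open>u\<close> on the ball within d of a compact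
      set, and a finite d-net \<open>Y\<close> of it serves to test L.\<close>
    from eventually_happens'[OF GK(1) this]
    obtain i0 where i0: "\<forall>x\<in>cball 0 1. norm (u x - u (K i0 x)) < d" ..
    have "compact (closure (K i0 ` cball 0 1))" using Kc unfolding compact_operator_def by blast
    moreover have "continuous_on (closure (K i0 ` cball 0 1)) u"
      by (rule poly_spaceE[OF uP]) (rule continuous_on_subset, auto)
    ultimately have C: "compact (u ` closure (K i0 ` cball 0 1))"
      by (rule compact_continuous_image[rotated])
    then have "compact (closure (u ` closure (K i0 ` cball 0 1)))"
      using compact_imp_closed[OF C] by (simp only: closure_closed)
    then obtain Y where Y: "finite Y" "\<And>x. x \<in> u ` closure (K i0 ` cball 0 1) \<Longrightarrow> \<exists>y\<in>Y. dist y x < d"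
      by (rule compact_closure_finite_net[OF _ d(1)]) (rule that)
    have evL: "\<forall>\<^sub>F j in GL. \<forall>y\<in>Y. dist (L j y) y < d"
      using tendsto_mono[OF GL(2) L_pointwise] d(1) by (intro eventually_ball_finite Y(1) ballI tendstoD)
    show "\<forall>\<^sub>F z in U. \<forall>x. norm x \<le> 1 \<longrightarrow> norm ((A z u - u) x) \<le> e"
      using evU[OF evK evL]
    proof (eventually_elim, intro allI impI)
      fix z :: "'i \<times> 'j" and x :: 'e
      assume *: "(\<forall>x\<in>cball 0 1. norm (u x - u (K (fst z) x)) < d) \<and> (\<forall>y\<in>Y. dist (L (snd z) y) y < d)"
        and x: "norm x \<le> 1"
      have "u (K i0 x) \<in> u ` closure (K i0 ` cball 0 1)"
        using x by (intro imageI subsetD[OF closure_subset]) auto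
      then obtain y where y: "y \<in> Y" "norm (y - u (K i0 x)) < d"
        using Y(2) by (auto simp: dist_norm)
      let ?w = "u (K (fst z) x)"
      have 1: "norm (u x - ?w) < d" "norm (u x - u (K i0 x)) < d" "norm (L (snd z) y - y) < d"
        using * i0 x y by (auto simp: dist_norm)
      have 2: "norm (y - u x) \<le> 2 * d"
        using norm_triangle_ineq4[of "y - u (K i0 x)" "u x - u (K i0 x)"] 1 y by simp
      have "norm (?w - y) \<le> 3 * d"
        using norm_triangle_ineq[of "?w - u x" "u x - y"] 1 2 by (simp add: norm_minus_commute)
      then have "M' * norm (?w - y) \<le> M' * (3 * d)" using M'(1) by (intro mult_left_mono)
      then have 3: "norm (L (snd z) (?w - y)) \<le> M' * (3 * d)" using M'(2) order_trans by blast
      have "norm (L (snd z) ?w - u x) = norm (L (snd z) (?w - y) + (L (snd z) y - y) + (y - u x))"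
        by (simp add: L_diff)
      also have "\<dots> \<le> norm (L (snd z) (?w - y)) + norm (L (snd z) y - y) + norm (y - u x)"
        by (meson add_right_mono norm_triangle_ineq order_trans)
      also have "\<dots> \<le> M' * (3 * d) + d + 2 * d" using 1 2 3 by linarith
      also have "\<dots> \<le> e" using d by (simp add: algebra_simps)
      finally show "norm ((A z u - u) x) \<le> e" by (simp add: A_def)
    qed
  qed
  interpret M_ideal_approximation "poly_scale sF" poly_norm "poly_space n sE sF" "weak_poly_space n sE sF" A B U
  proof unfold_locales
    show "V.subspace (poly_space n sE sF)"
      by (rule V.subspaceI[OF poly_space_zero poly_space_add poly_space_scale])
    show "V.subspace (weak_poly_space n sE sF)"
    proof (rule V.subspaceI[OF _ weak_poly_space_add weak_poly_space_scale])
      show "0 \<in> weak_poly_space n sE sF"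
        by (rule weak_poly_spaceI[OF poly_space_zero]) (simp add: zero_fun_def)
    qed
    show "weak_poly_space n sE sF \<subseteq> poly_space n sE sF" by (rule weak_poly_space_subset)
    show "poly_norm (poly_scale sF c v) = norm c * poly_norm v" if "v \<in> poly_space n sE sF" for c v
    proof (rule antisym)
      have le: "poly_norm (poly_scale sF c v) \<le> norm c * poly_norm v" if v: "v \<in> poly_space n sE sF" for c v
      proof (rule poly_norm_least)
        fix x :: 'e assume x: "norm x \<le> 1"
        have "norm (v x) \<le> poly_norm v" unfolding poly_norm_def
          by (rule cSUP_upper[OF _ poly_norm_bdd[OF v]]) (simp add: x)
        then show "norm (poly_scale sF c v x) \<le> norm c * poly_norm v"
          by (simp add: poly_scale_def F.norm_scale mult_left_mono)
      qed
      show "poly_norm (poly_scale sF c v) \<le> norm c * poly_norm v" using le[OF that] .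
      show "norm c * poly_norm v \<le> poly_norm (poly_scale sF c v)"
      proof (cases "c = 0")
        case True
        then show ?thesis using poly_norm_nonneg[OF poly_space_scale[OF that], of c] by (simp only: norm_zero mult_zero_left)
      next
        case False
        \<comment> \<open>The reverse inequality is the first one for the inverse scalar, applied to
          the scaled polynomial.\<close>
        have "poly_norm (poly_scale sF (inverse c) (poly_scale sF c v)) \<le> norm (inverse c) * poly_norm (poly_scale sF c v)"
          by (rule le[OF poly_space_scale[OF that]])
        then show ?thesis using False by (simp add: norm_divide field_simps)
      qed
    qed
    show "((\<lambda>g. poly_norm (A g u - u)) \<longlongrightarrow> 0) U" if "u \<in> weak_poly_space n sE sF" for u
      using A_lim[OF that] .
    show "((\<lambda>g. poly_norm (B g u)) \<longlongrightarrow> 0) U" if "u \<in> weak_poly_space n sE sF" for u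
      using B_lim[OF that] .
    fix e :: real assume e: "e > 0"
    \<comment> \<open>The estimate for A P + B Q has the constant (1 + t)^(n+1), which a small t > 0
      brings below 1 + e.\<close>
    have "((\<lambda>t. (1 + t) * (1 + t) ^ n) \<longlongrightarrow> (1 + 0) * (1 + 0) ^ n) (at_right (0::real))"
      by (intro tendsto_intros)
    then have "\<forall>\<^sub>F t in at_right (0::real). (1 + t) * (1 + t) ^ n < 1 + e"
      using e by (intro order_tendstoD(2)) auto
    moreover have "\<forall>\<^sub>F t in at_right (0::real). t > 0" by (simp add: eventually_at_right_less)
    ultimately have "\<forall>\<^sub>F t in at_right (0::real). t > 0 \<and> (1 + t) * (1 + t) ^ n < 1 + e"
      by eventually_elim blast
    from eventually_happens'[OF _ this]
    obtain t :: real where t: "t > 0" "(1 + t) * (1 + t) ^ n < 1 + e" by auto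
    show "\<forall>\<^sub>F g in U. \<forall>P\<in>poly_space n sE sF. \<forall>Q\<in>poly_space n sE sF.
        poly_norm (A g P + B g Q) \<le> (1 + e) * max (poly_norm P) (poly_norm Q)"
      using evU[OF GK(3)[OF t(1)] GL(3)[OF t(1)]]
    proof (eventually_elim, intro ballI)
      fix z :: "'i \<times> 'j" and P Q :: "'e \<Rightarrow> 'f"
      assume good: "goodK t (fst z) \<and> goodL t (snd z)"
        and P: "P \<in> poly_space n sE sF" and Q: "Q \<in> poly_space n sE sF"
      have "max (poly_norm P) (poly_norm Q) \<ge> 0" using poly_norm_nonneg[OF P] by (simp add: le_max_iff_disj)
      then have "(1 + t) * (1 + t) ^ n * max (poly_norm P) (poly_norm Q) \<le> (1 + e) * max (poly_norm P) (poly_norm Q)"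
        using t by (intro mult_right_mono) auto
      moreover have "poly_norm (A z P + B z Q) \<le> (1 + t) * max (poly_norm P) (poly_norm Q) * (1 + t) ^ n"
        using good by (intro poly_norm_least norm_AB[OF _ _ t(1) P Q]) auto
      ultimately show "poly_norm (A z P + B z Q) \<le> (1 + e) * max (poly_norm P) (poly_norm Q)"
        by (simp add: mult_ac)
    qed
  qed (use U A_weak B_weak poly_norm_nonneg weak_poly_space_closed in
      \<open>auto simp: A_def B_def fun_eq_iff poly_scale_def L_add L_scale F.scale_right_diff_distrib\<close>)
  show ?thesis by (rule M_idealI)
qed

end
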